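(* Assume that for every $t$ the local noises $w^1_t,\ldots,w^n_t$ are exchangeable. Let $\varepsilon>0$, let $c_{\max}$ bound the per-step cost, and let $k\in\mathbb{N}$ satisfy $k\ge\log\!\big(\tfrac{(1-\gamma)\varepsilon}{2c_{\max}}\big)/\log\gamma$. Run the following Q-learning procedure: $Q_1(x,y,a)=0$, and at iteration $\tau$, for a state $(x,y)\in\mathcal{M}(n)\times\{0,\ldots,k\}$ and action $a\in\{0,1\}$, $$Q_{\tau+1}(x,y,a)=(1-\alpha_\tau(x,y,a))Q_\tau(x,y,a)+\alpha_\tau(x,y,a)\big(c'+\gamma\min_{a'\in\{0,1\}}Q_\tau(x',y',a')\big),$$ where $c'$ is the immediate cost incurred, $(x',y')=\tilde f(x,y,o)$ with $o$ the observation received next, and learning rates $\alpha_\tau(x,y,a)\in[0,1]$ satisfy $\sum_\tau\alpha_\tau(x,y,a)=\infty$ and $\sum_\tau\alpha_\tau(x,y,a)^2<\infty$. Suppose every pair $(x,y)\in\mathcal{M}(n)\times\{0,\ldots,k\}$, $a\in\{0,1\}$ is updated infinitely often. Then (a) for every $(x,y,a)$, $Q_\tau(x,y,a)\to Q^\ast(x,y,a)$ with probability one; (b) any greedy strategy $g^\ast_\varepsilon(x,y)\in\arg\min_{a}Q^\ast(x,y,a)$ is $\varepsilon$-optimal, i.e. $J(g^\ast_\varepsilon)\le J(g)+\varepsilon$ for every strategy $g$, and this holds even when the model $(f,q,c,$ noise distribution$)$ is not known.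
   Context: Setting: $n$ nodes with states $s^i_t$ in a finite set $\mathcal{S}\subset\mathbb{R}$, time $t\in\mathbb{N}$; empirical distribution $m_t(s)=\frac1n\sum_i\mathbb{1}\{s^i_t=s\}\in\mathcal{M}(n)$ (probability vectors on $\mathcal{S}$ with entries in $\{0,\frac1n,\ldots,1\}$); dynamics $s^i_{t+1}=f(s^i_t,m_t,w^i_t)$, local noise $w^i_t$ in a finite set $\mathcal{W}$. Action $a_t\in\{0,1\}$ (1 = collect). Observations $o_t\in\mathcal{O}=\mathcal{M}(n)\cup\{\mathtt{blank}\}$: $o_1=m_1$; $a_t=0\Rightarrow o_{t+1}=\mathtt{blank}$; $a_t=1\Rightarrow o_{t+1}=m_{t+1}$ w.p. $q\in[0,1]$, else $\mathtt{blank}$. Strategies $a_t=g_t(o_{1:t},a_{1:t-1})$. Primitive random variables are mutually independent with finite variances. Estimate $\hat m_t=h(\mathbb{P}(m_t\mid o_{1:t},a_{1:t-1}))$ for fixed $h$; per-step cost $c(m_t,\hat m_t,a_t)\ge0$; $J(g)=\mathbb{E}^g[\sum_t\gamma^{t-1}c(m_t,\hat m_t,a_t)]$, $\gamma\in(0,1)$. $T_{\mathsf m}(m',m)=\mathbb{P}(m_{t+1}=m'\mid m_t=m)$ is the transition matrix of the Markov chain $m_t$, $T_{\mathsf m}^y$ its $y$-th power. $\hat c(x,y,a)=\sum_{m}c(m,h(T_{\mathsf m}^y(\cdot,x)),a)T_{\mathsf m}^y(m,x)$. Fix $m^\ast\in\mathcal{M}(n)$ and define $\tilde f(x,y,o)=(x,y+1)$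 if $o=\mathtt{blank}$ and $y<k$; $=(m^\ast,0)$ if $o=\mathtt{blank}$ and $y=k$; $=(o,0)$ if $o\ne\mathtt{blank}$. $\mathbb{P}(o\mid x,y,a)=(1-aq)\mathbb{1}\{o=\mathtt{blank}\}+aqT_{\mathsf m}^{y+1}(o,x)\mathbb{1}\{o\neq\mathtt{blank}\}$. $Q^\ast$ is the unique function on $\mathcal{M}(n)\times\{0,\ldots,k\}\times\{0,1\}$ satisfying $Q^\ast(x,y,a)=\hat c(x,y,a)+\gamma\sum_{o\in\mathcal{O}}\mathbb{P}(o\mid x,y,a)\min_{a'}Q^\ast(\tilde f(x,y,o),a')$. *)

theory Defs
  imports "HOL-Probability.Probability" "HOL-Combinatorics.Permutations"
begin

(* Node states: elements of a finite type 's (the finite set S).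
   A configuration of the n nodes is a list of length n.
   Empirical distributions m :: 's => real. Observations: None = blank, Some m. *)

definition emp :: "'s list \<Rightarrow> 's \<Rightarrow> real" where
  "emp s = (\<lambda>\<sigma>. real (count_list s \<sigma>) / real (length s))"

definition Mn :: "nat \<Rightarrow> ('s::finite \<Rightarrow> real) set" where
  "Mn n = {m. (\<forall>\<sigma>. \<exists>j\<le>n. m \<sigma> = real j / real n) \<and> (\<Sum>\<sigma>\<in>UNIV. m \<sigma>) = 1}"

(* the joint law W of (w^1_t,...,w^n_t) (same for every t) is exchangeable *)
definition exchangeable :: "nat \<Rightarrow> 'w list pmf \<Rightarrow> bool" where
  "exchangeable n W \<longleftrightarrow> (\<forall>ws\<in>set_pmf W. length ws = n) \<and>
     (\<forall>\<pi>. \<pi> permutes {..<n} \<longrightarrow> map_pmf (\<lambda>ws. map (\<lambda>i. ws ! \<pi> i) [0..<n]) W = W)"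

(* transition matrix T_m(m',m) = P(m_{t+1} = m' | m_t = m), computed from any
   configuration with empirical distribution m (well-defined by exchangeability) *)
definition Tm :: "nat \<Rightarrow> ('s \<Rightarrow> ('s \<Rightarrow> real) \<Rightarrow> 'w \<Rightarrow> 's) \<Rightarrow> 'w list pmf
                  \<Rightarrow> ('s \<Rightarrow> real) \<Rightarrow> ('s \<Rightarrow> real) \<Rightarrow> real" where
  "Tm n f W m' m = (let s = (SOME s. length s = n \<and> emp s = m) in
      measure_pmf.prob W {ws. emp (map2 (\<lambda>si wi. f si m wi) s ws) = m'})"

fun Tpow :: "nat \<Rightarrow> ('s::finite \<Rightarrow> ('s \<Rightarrow> real) \<Rightarrow> 'w \<Rightarrow> 's) \<Rightarrow> 'w list pmf \<Rightarrow> nat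
              \<Rightarrow> ('s \<Rightarrow> real) \<Rightarrow> ('s \<Rightarrow> real) \<Rightarrow> real" where
  "Tpow n f W 0 m' m = (if m' = m then 1 else 0)"
| "Tpow n f W (Suc y) m' m = (\<Sum>m''\<in>Mn n. Tm n f W m' m'' * Tpow n f W y m'' m)"

definition chat :: "nat \<Rightarrow> ('s::finite \<Rightarrow> ('s \<Rightarrow> real) \<Rightarrow> 'w \<Rightarrow> 's) \<Rightarrow> 'w list pmf
     \<Rightarrow> (('s \<Rightarrow> real) \<Rightarrow> 'e \<Rightarrow> bool \<Rightarrow> real) \<Rightarrow> ((('s \<Rightarrow> real) \<Rightarrow> real) \<Rightarrow> 'e)
     \<Rightarrow> ('s \<Rightarrow> real) \<Rightarrow> nat \<Rightarrow> bool \<Rightarrow> real" where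
  "chat n f W c h x y a = (\<Sum>m\<in>Mn n. c m (h (\<lambda>m0. Tpow n f W y m0 x)) a * Tpow n f W y m x)"

definition ftilde :: "nat \<Rightarrow> ('s \<Rightarrow> real) \<Rightarrow> ('s \<Rightarrow> real) \<Rightarrow> nat \<Rightarrow> ('s \<Rightarrow> real) option
                      \<Rightarrow> ('s \<Rightarrow> real) \<times> nat" where
  "ftilde k mstar x y ob = (case ob of
       None \<Rightarrow> (if y < k then (x, Suc y) else (mstar, 0))
     | Some o' \<Rightarrow> (o', 0))"

definition Pobs :: "nat \<Rightarrow> ('s::finite \<Rightarrow> ('s \<Rightarrow> real) \<Rightarrow> 'w \<Rightarrow> 's) \<Rightarrow> 'w list pmf \<Rightarrow> real
     \<Rightarrow> ('s \<Rightarrow> real) \<Rightarrow> nat \<Rightarrow> bool \<Rightarrow> ('s \<Rightarrow> real) option \<Rightarrow> real" where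
  "Pobs n f W q x y a ob = (case ob of
       None \<Rightarrow> 1 - (if a then q else 0)
     | Some o' \<Rightarrow> (if a then q else 0) * Tpow n f W (Suc y) o' x)"

(* M(n) x {0..k} x {0,1} (action 1 = True) *)
definition Dom :: "nat \<Rightarrow> nat \<Rightarrow> (('s::finite \<Rightarrow> real) \<times> nat \<times> bool) set" where
  "Dom n k = Mn n \<times> {0..k} \<times> UNIV"

definition Qstar :: "nat \<Rightarrow> nat \<Rightarrow> ('s::finite \<Rightarrow> ('s \<Rightarrow> real) \<Rightarrow> 'w \<Rightarrow> 's) \<Rightarrow> 'w list pmf
     \<Rightarrow> real \<Rightarrow> (('s \<Rightarrow> real) \<Rightarrow> 'e \<Rightarrow> bool \<Rightarrow> real) \<Rightarrow> ((('s \<Rightarrow> real) \<Rightarrow> real) \<Rightarrow> 'e)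
     \<Rightarrow> real \<Rightarrow> ('s \<Rightarrow> real) \<Rightarrow> (('s \<Rightarrow> real) \<times> nat \<times> bool) \<Rightarrow> real" where
  "Qstar n k f W q c h \<gamma> mstar = (THE Q.
      (\<forall>z. z \<notin> Dom n k \<longrightarrow> Q z = 0) \<and>
      (\<forall>x y a. (x, y, a) \<in> Dom n k \<longrightarrow>
         Q (x, y, a) = chat n f W c h x y a + \<gamma> *
           (\<Sum>ob\<in>insert None (Some ` Mn n). Pobs n f W q x y a ob *
              (case ftilde k mstar x y ob of (x', y') \<Rightarrow> min (Q (x', y', False)) (Q (x', y', True))))))"

(* joint law at (0-based) time t of (s_t, o_{1:t}, a_{1:t-1}); strategy g t os as *)
primrec Dproc :: "('s \<Rightarrow> ('s \<Rightarrow> real) \<Rightarrow> 'w \<Rightarrow> 's) \<Rightarrow> 'w list pmf \<Rightarrow> real \<Rightarrow> 's list pmf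
     \<Rightarrow> (nat \<Rightarrow> ('s \<Rightarrow> real) option list \<Rightarrow> bool list \<Rightarrow> bool) \<Rightarrow> nat
     \<Rightarrow> ('s list \<times> ('s \<Rightarrow> real) option list \<times> bool list) pmf" where
  "Dproc f W q S1 g 0 = map_pmf (\<lambda>s. (s, [Some (emp s)], [])) S1"
| "Dproc f W q S1 g (Suc t) = Dproc f W q S1 g t \<bind> (\<lambda>(s, os, as).
      let a = g t os as in
      W \<bind> (\<lambda>ws. let s' = map2 (\<lambda>si wi. f si (emp s) wi) s ws in
        (if a then bernoulli_pmf q else return_pmf False) \<bind> (\<lambda>b.
          return_pmf (s', os @ [if b then Some (emp s') else None], as @ [a]))))"

definition belief :: "('s list \<times> ('s \<Rightarrow> real) option list \<times> bool list) pmf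
     \<Rightarrow> ('s \<Rightarrow> real) option list \<Rightarrow> bool list \<Rightarrow> ('s \<Rightarrow> real) \<Rightarrow> real" where
  "belief D os as = (\<lambda>m.
     measure_pmf.prob D {(s, os', as'). os' = os \<and> as' = as \<and> emp s = m} /
     measure_pmf.prob D {(s, os', as'). os' = os \<and> as' = as})"

definition Jval :: "('s \<Rightarrow> ('s \<Rightarrow> real) \<Rightarrow> 'w \<Rightarrow> 's) \<Rightarrow> 'w list pmf \<Rightarrow> real \<Rightarrow> 's list pmf
     \<Rightarrow> (('s \<Rightarrow> real) \<Rightarrow> 'e \<Rightarrow> bool \<Rightarrow> real) \<Rightarrow> ((('s \<Rightarrow> real) \<Rightarrow> real) \<Rightarrow> 'e) \<Rightarrow> real
     \<Rightarrow> (nat \<Rightarrow> ('s \<Rightarrow> real) option list \<Rightarrow> bool list \<Rightarrow> bool) \<Rightarrow> real" where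
  "Jval f W q S1 c h \<gamma> g = (\<Sum>t. \<gamma> ^ t * measure_pmf.expectation (Dproc f W q S1 g t)
      (\<lambda>(s, os, as). c (emp s) (h (belief (Dproc f W q S1 g t) os as)) (g t os as)))"

definition track :: "nat \<Rightarrow> ('s \<Rightarrow> real) \<Rightarrow> ('s \<Rightarrow> real) option list \<Rightarrow> ('s \<Rightarrow> real) \<times> nat" where
  "track k mstar os = foldl (\<lambda>(x, y) ob. ftilde k mstar x y ob) (the (hd os), 0) (tl os)"

definition sample_law :: "nat \<Rightarrow> ('s::finite \<Rightarrow> ('s \<Rightarrow> real) \<Rightarrow> 'w \<Rightarrow> 's) \<Rightarrow> 'w list pmf \<Rightarrow> real
     \<Rightarrow> (('s \<Rightarrow> real) \<times> nat \<times> bool) \<Rightarrow> (('s \<Rightarrow> real) \<times> ('s \<Rightarrow> real) \<times> bool) \<Rightarrow> real" where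
  "sample_law n f W q z v = (case z of (x, y, a) \<Rightarrow> case v of (m, m', b) \<Rightarrow>
      (if m \<in> Mn n \<and> m' \<in> Mn n then Tpow n f W y m x * Tm n f W m' m * (if b then q else 1 - q)
       else 0))"

(* Q-learning iterates; Q_0 = 0 (the paper's Q_1). The sample (m,m',b) gives the
   incurred cost c' = c(m, h(T^y(.,x)), a) and observation o = m' if a and b, else blank *)
primrec Qlearn :: "nat \<Rightarrow> nat \<Rightarrow> ('s::finite \<Rightarrow> ('s \<Rightarrow> real) \<Rightarrow> 'w \<Rightarrow> 's) \<Rightarrow> 'w list pmf
     \<Rightarrow> (('s \<Rightarrow> real) \<Rightarrow> 'e \<Rightarrow> bool \<Rightarrow> real) \<Rightarrow> ((('s \<Rightarrow> real) \<Rightarrow> real) \<Rightarrow> 'e)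
     \<Rightarrow> real \<Rightarrow> ('s \<Rightarrow> real)
     \<Rightarrow> (nat \<Rightarrow> (('s \<Rightarrow> real) \<times> nat \<times> bool) \<Rightarrow> 'om \<Rightarrow> real)
     \<Rightarrow> (nat \<Rightarrow> (('s \<Rightarrow> real) \<times> nat \<times> bool) \<Rightarrow> 'om \<Rightarrow> ('s \<Rightarrow> real) \<times> ('s \<Rightarrow> real) \<times> bool)
     \<Rightarrow> nat \<Rightarrow> (('s \<Rightarrow> real) \<times> nat \<times> bool) \<Rightarrow> 'om \<Rightarrow> real" where
  "Qlearn n k f W c h \<gamma> mstar \<alpha> \<xi> 0 z \<omega> = 0"
| "Qlearn n k f W c h \<gamma> mstar \<alpha> \<xi> (Suc \<tau>) z \<omega> =
     (case z of (x, y, a) \<Rightarrow> case \<xi> \<tau> z \<omega> of (m, m', b) \<Rightarrow>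
       (let c' = c m (h (\<lambda>m0. Tpow n f W y m0 x)) a;
            ob = (if a \<and> b then Some m' else None)
        in case ftilde k mstar x y ob of (x', y') \<Rightarrow>
          (1 - \<alpha> \<tau> z \<omega>) * Qlearn n k f W c h \<gamma> mstar \<alpha> \<xi> \<tau> z \<omega>
          + \<alpha> \<tau> z \<omega> * (c' + \<gamma> * min (Qlearn n k f W c h \<gamma> mstar \<alpha> \<xi> \<tau> (x', y', False) \<omega>)
                                      (Qlearn n k f W c h \<gamma> mstar \<alpha> \<xi> \<tau> (x', y', True) \<omega>))))"

end

theory Submission
  imports Defs
begin

text \<open>
  Convergence: the martingale noise of the iteration is square summable after localisation, so the
  noise series weighted by the step sizes converges almost surely and the averaged noise tends to
  zero. Subtracting it leaves a weighted average of \<open>\<gamma>\<close>-contractions, and any asymptotic bound on the error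
  is improved by a factor arbitrarily close to \<open>\<gamma>\<close>.

  Optimality: by exchangeability the empirical distribution is a Markov chain, so the belief is
  \<open>T\<^sup>y(\<cdot>, x)\<close>, where \<open>x\<close> is the last observation and \<open>y\<close> its age. The truncated
  recursion agrees with the true one up to time \<open>k\<close>, since the age cannot exceed the elapsed
  time. Iterating the Bellman equation \<open>k + 1\<close> times bounds the cost of every strategy below, and
  that of the greedy strategy above, by the same number up to
  \<open>\<gamma>\<^bsup>k+1\<^esup> c\<^sub>m\<^sub>a\<^sub>x / (1 - \<gamma>)\<close>, which is at most \<open>\<epsilon> / 2\<close>.
\<close>

section \<open>Deterministic averaging recursions\<close>

text \<open>Each pair has its own random step sizes, so the coordinates run on different clocks and
  no common rate or norm recursion is available. Probability is therefore confined to one scalar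
  noise series per pair; everything after that is deterministic along a path. A priori boundedness
  comes from the form of the update: an iterate is a convex combination of its predecessor and a
  target, and costs lie in \<open>[0, cmax]\<close>, so iterates started at 0 stay in
  \<open>[0, cmax / (1 - \<gamma>)]\<close>.

  On the control side no value function on beliefs is built: \<open>Qstar\<close> is evaluated along
  the tracked pair of an arbitrary strategy. After a reset to the arbitrary point
  \<open>mstar\<close> this pair says nothing about the true belief, but a reset can show up at time
  \<open>k + 1\<close> at the earliest, and there only the bounds on the value are used. The lower
  estimate for the competitor and the upper estimate for the greedy strategy each lose one such
  term, whence the 2 in the condition on \<open>k\<close>.\<close>

lemma averaging_recursion_eventually_le:
  fixes x \<alpha> b :: "nat \<Rightarrow> real"
  assumes rec: "\<And>t. x (Suc t) \<le> (1 - \<alpha> t) * x t + \<alpha> t * b t"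
    and \<alpha>: "\<And>t. 0 \<le> \<alpha> t" "\<And>t. \<alpha> t \<le> 1"
    and div: "filterlim (\<lambda>N. \<Sum>t<N. \<alpha> t) at_top sequentially"
    and b: "eventually (\<lambda>t. b t \<le> B) sequentially"
    and e: "0 < e"
  shows "eventually (\<lambda>t. x t \<le> B + e) sequentially"
proof -
  obtain N where N: "\<And>t. N \<le> t \<Longrightarrow> b t \<le> B"
    using b by (auto simp: eventually_sequentially)
  \<comment> \<open>Once \<open>b t \<le> B\<close>, a step multiplies the excess over
    \<open>B\<close> by at most \<open>1 - \<alpha> t \<le> exp (- \<alpha> t)\<close>, so it decays
    like the exponential of minus the sum of the steps. Clipping at 0 keeps the bound nonnegative,
    as passing to the exponential requires.\<close>
  define K where "K = max (x N - B) 0"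
  define S where "S t = (\<Sum>s<t. \<alpha> s)" for t
  have decay: "x t - B \<le> K * exp (S N - S t)" if "N \<le> t" for t
    using that
  proof (induction t rule: dec_induct)
    case base
    show ?case by (simp add: K_def)
  next
    case (step t)
    have "x (Suc t) - B \<le> (1 - \<alpha> t) * (x t - B)"
      using rec[of t] mult_left_mono[OF N[OF step(1)] \<alpha>(1)[of t]] by (simp add: algebra_simps)
    also have "\<dots> \<le> (1 - \<alpha> t) * (K * exp (S N - S t))"
      using step(3) \<alpha>(2)[of t] by (intro mult_left_mono) auto
    also have "\<dots> \<le> exp (- \<alpha> t) * (K * exp (S N - S t))"
      using exp_ge_add_one_self[of "- \<alpha> t"] by (intro mult_right_mono) (auto simp: K_def)
    also have "\<dots> = K * exp (S N - S (Suc t))"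
      by (simp add: S_def mult.left_commute flip: exp_add)
    finally show ?case .
  qed
  have "filterlim (\<lambda>t. - S N + S t) at_top sequentially"
    using div unfolding S_def by (intro filterlim_tendsto_add_at_top[OF tendsto_const])
  hence "filterlim (\<lambda>t. S N - S t) at_bot sequentially"
    by (simp add: filterlim_uminus_at_bot)
  hence "(\<lambda>t. exp (S N - S t)) \<longlonglongrightarrow> 0"
    by (rule filterlim_compose[OF exp_at_bot])
  hence "(\<lambda>t. K * exp (S N - S t)) \<longlonglongrightarrow> 0"
    by (rule tendsto_mult_right_zero)
  hence "eventually (\<lambda>t. K * exp (S N - S t) < e) sequentially"
    using e by (rule order_tendstoD)
  with eventually_ge_at_top[of N] show ?thesis
    by eventually_elim (use decay in fastforce)
qed

text \<open>A pathwise counterpart of Kronecker's lemma: \<open>w\<close> itself need not tend to 0,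
  cancellation in the weighted series is enough.\<close>

lemma averaged_noise_tendsto_zero:
  fixes U w \<alpha> :: "nat \<Rightarrow> real"
  assumes rec: "\<And>t. U (Suc t) = (1 - \<alpha> t) * U t + \<alpha> t * w t"
    and \<alpha>: "\<And>t. 0 \<le> \<alpha> t" "\<And>t. \<alpha> t \<le> 1"
    and div: "filterlim (\<lambda>N. \<Sum>t<N. \<alpha> t) at_top sequentially"
    and conv: "convergent (\<lambda>N. \<Sum>t<N. \<alpha> t * w t)"
  shows "U \<longlonglongrightarrow> 0"
proof -
  obtain L where L: "(\<lambda>N. \<Sum>t<N. \<alpha> t * w t) \<longlonglongrightarrow> L"
    using conv by (auto simp: convergent_def)
  define S where "S t = L - (\<Sum>s<t. \<alpha> s * w s)" for t
  have S: "S \<longlonglongrightarrow> 0"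
    using tendsto_diff[OF tendsto_const[of L] L] by (simp add: S_def[abs_def])
  \<comment> \<open>Adding the tail of the noise series turns the noise into the vanishing driving term \<^term>\<open>S\<close>.\<close>
  define Y where "Y t = U t + S t" for t
  have Yrec: "Y (Suc t) = (1 - \<alpha> t) * Y t + \<alpha> t * S t" for t
    by (simp add: Y_def S_def rec algebra_simps)
  have "\<bar>Y (Suc t)\<bar> \<le> (1 - \<alpha> t) * \<bar>Y t\<bar> + \<alpha> t * \<bar>S t\<bar>" for t
    unfolding Yrec using abs_triangle_ineq[of "(1 - \<alpha> t) * Y t" "\<alpha> t * S t"] \<alpha>[of t]
    by (simp add: abs_mult)
  note ev = averaging_recursion_eventually_le[OF this \<alpha> div]
  have "Y \<longlonglongrightarrow> 0"
  proof (rule tendstoI)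
    fix e :: real assume "0 < e"
    have "eventually (\<lambda>t. \<bar>S t\<bar> \<le> e / 3) sequentially"
      using tendstoD[OF S, of "e/3"] \<open>0 < e\<close> by (auto elim!: eventually_mono simp: dist_real_def)
    from ev[OF this, of "e/3"] show "eventually (\<lambda>t. dist (Y t) 0 < e) sequentially"
      using \<open>0 < e\<close> by (auto elim!: eventually_mono simp: dist_real_def)
  qed
  from tendsto_diff[OF this S] show ?thesis by (simp add: Y_def)
qed

text \<open>The contraction compares one coordinate of \<open>H\<close> with the supremum over all
  coordinates of \<open>D\<close>. So the bound that is improved must be a common one: each
  coordinate reaches the smaller bound in its own time, and finiteness of \<open>Z\<close> provides
  a time after which all of them have.\<close>

lemma asynchronous_contraction_tendsto_zero:
  fixes D H w \<alpha> :: "nat \<Rightarrow> 'z \<Rightarrow> real"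
  assumes fin: "finite Z"
    and \<gamma>: "0 < \<gamma>" "\<gamma> < 1"
    and rec: "\<And>t z. z \<in> Z \<Longrightarrow> D (Suc t) z = (1 - \<alpha> t z) * D t z + \<alpha> t z * (H t z + w t z)"
    and contr: "\<And>t z B. z \<in> Z \<Longrightarrow> (\<And>z'. z' \<in> Z \<Longrightarrow> \<bar>D t z'\<bar> \<le> B) \<Longrightarrow> \<bar>H t z\<bar> \<le> \<gamma> * B"
    and bdd: "\<And>t z. z \<in> Z \<Longrightarrow> \<bar>D t z\<bar> \<le> K"
    and \<alpha>: "\<And>t z. z \<in> Z \<Longrightarrow> 0 \<le> \<alpha> t z" "\<And>t z. z \<in> Z \<Longrightarrow> \<alpha> t z \<le> 1"
    and div: "\<And>z. z \<in> Z \<Longrightarrow> filterlim (\<lambda>N. \<Sum>t<N. \<alpha> t z) at_top sequentially"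
    and conv: "\<And>z. z \<in> Z \<Longrightarrow> convergent (\<lambda>N. \<Sum>t<N. \<alpha> t z * w t z)"
    and z: "z \<in> Z"
  shows "(\<lambda>t. D t z) \<longlonglongrightarrow> 0"
proof -
  \<comment> \<open>The response of the recursion to the noise alone. What remains,
    \<open>X\<close>, is driven by \<open>H\<close>, which is still evaluated at \<open>D\<close>;
    hence bounds on \<open>D\<close> control it without any linearity of \<open>H\<close>.\<close>
  define U where "U z = rec_nat 0 (\<lambda>t u. (1 - \<alpha> t z) * u + \<alpha> t z * w t z)" for z
  have Urec: "U z (Suc t) = (1 - \<alpha> t z) * U z t + \<alpha> t z * w t z" for z t
    by (simp add: U_def)
  have U0: "U z \<longlonglongrightarrow> 0" if "z \<in> Z" for z
    by (rule averaged_noise_tendsto_zero[OF Urec \<alpha>(1)[OF that] \<alpha>(2)[OF that] div[OF that] conv[OF that]])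
  define X where "X z t = D t z - U z t" for z t
  have Xrec: "X z (Suc t) = (1 - \<alpha> t z) * X z t + \<alpha> t z * H t z" if "z \<in> Z" for z t
    using that by (simp add: X_def rec Urec algebra_simps)
  have Xabs: "\<bar>X z (Suc t)\<bar> \<le> (1 - \<alpha> t z) * \<bar>X z t\<bar> + \<alpha> t z * \<bar>H t z\<bar>" if "z \<in> Z" for z t
    unfolding Xrec[OF that]
    using abs_triangle_ineq[of "(1 - \<alpha> t z) * X z t" "\<alpha> t z * H t z"] \<alpha>[OF that, of t]
    by (simp add: abs_mult)
  define \<delta> where "\<delta> = (1 + \<gamma>) / 2"
  have \<delta>: "0 < \<delta>" "\<delta> < 1" "\<gamma> < \<delta>"
    using \<gamma> by (auto simp: \<delta>_def)
  define K' where "K' = max K 1"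
  have K': "0 < K'" by (simp add: K'_def)
  have ev: "eventually (\<lambda>t. \<forall>z\<in>Z. \<bar>D t z\<bar> \<le> \<delta> ^ j * K') sequentially" for j
  proof (induction j)
    case 0
    show ?case using bdd by (auto simp: K'_def intro!: always_eventually max.coboundedI1)
  next
    case (Suc j)
    \<comment> \<open>The slack between \<open>\<gamma>\<close> and \<open>\<delta>\<close> pays for
      two errors of size \<open>e\<close>: that of the averaging recursion for \<open>X\<close> and
      that of the vanishing term \<open>U\<close>. Positivity of \<open>K'\<close> makes
      \<open>e\<close> positive.\<close>
    define e where "e = (\<delta> - \<gamma>) * (\<delta> ^ j * K') / 2"
    have e: "0 < e" using \<delta> K' by (simp add: e_def)
    have "eventually (\<lambda>t. \<bar>D t z\<bar> \<le> \<delta> ^ Suc j * K') sequentially" if "z \<in> Z" for z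
    proof -
      have "eventually (\<lambda>t. \<bar>H t z\<bar> \<le> \<gamma> * (\<delta> ^ j * K')) sequentially"
        using Suc by eventually_elim (intro contr that, auto)
      from averaging_recursion_eventually_le[OF Xabs \<alpha> div this e, OF that that that that]
      have 1: "eventually (\<lambda>t. \<bar>X z t\<bar> \<le> \<gamma> * (\<delta> ^ j * K') + e) sequentially" .
      have 2: "eventually (\<lambda>t. \<bar>U z t\<bar> < e) sequentially"
        using tendstoD[OF U0[OF that] e] by (simp add: dist_real_def)
      from 1 2 show ?thesis
      proof eventually_elim
        case (elim t)
        have "\<gamma> * (\<delta> ^ j * K') + e + e = \<delta> ^ Suc j * K'"
          by (simp add: e_def field_simps)
        thus ?case using elim by (simp add: X_def)
      qed
    qed
    thus ?case using fin by (simp add: eventually_ball_finite)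
  qed
  show ?thesis
  proof (rule tendstoI)
    fix e :: real assume "0 < e"
    have "(\<lambda>j. \<delta> ^ j * K') \<longlonglongrightarrow> 0"
      using \<delta> by (intro tendsto_mult_left_zero LIMSEQ_power_zero) auto
    from order_tendstoD(2)[OF this \<open>0 < e\<close>] obtain j where j: "\<delta> ^ j * K' < e"
      by (auto simp: eventually_sequentially)
    from ev[of j] show "eventually (\<lambda>t. dist (D t z) 0 < e) sequentially"
      by eventually_elim (use j z in \<open>fastforce simp: dist_real_def\<close>)
  qed
qed

section \<open>Almost sure convergence of martingale difference series\<close>

context prob_space
begin

lemma integrable_bounded:
  fixes u :: "'a \<Rightarrow> real"
  assumes "u \<in> borel_measurable M" "\<And>\<omega>. \<omega> \<in> space M \<Longrightarrow> \<bar>u \<omega>\<bar> \<le> K"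
  shows "integrable M u"
  using assms by (intro integrable_const_bound[of _ K]) auto

text \<open>Kolmogorov's inequality. The decision to stop before step \<open>t\<close> is
  \<open>F t\<close>-measurable, so stopping at the first exit preserves orthogonality of the
  increments; Markov's inequality for the square at time \<open>N\<close> then covers all earlier
  exits, because the stopped sum stays where it left.\<close>

lemma martingale_difference_maximal_inequality:
  fixes d :: "nat \<Rightarrow> 'a \<Rightarrow> real"
  assumes subalg: "\<And>t. subalgebra M (F t)"
    and mono: "\<And>t. sets (F t) \<subseteq> sets (F (Suc t))"
    and meas: "\<And>t. d t \<in> borel_measurable (F (Suc t))"
    and bdd: "\<And>t \<omega>. \<omega> \<in> space M \<Longrightarrow> \<bar>d t \<omega>\<bar> \<le> B"
    and orth: "\<And>t Y C. Y \<in> borel_measurable (F t) \<Longrightarrow> (\<And>\<omega>. \<omega> \<in> space M \<Longrightarrow> \<bar>Y \<omega>\<bar> \<le> C) \<Longrightarrow>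
                 expectation (\<lambda>\<omega>. Y \<omega> * d t \<omega>) = 0"
    and \<eta>: "0 < \<eta>"
  shows "prob {\<omega>\<in>space M. \<exists>j\<le>N. \<eta> \<le> \<bar>\<Sum>t<j. d t \<omega>\<bar>} \<le> (\<Sum>t<N. expectation (\<lambda>\<omega>. (d t \<omega>)\<^sup>2)) / \<eta>\<^sup>2"
proof -
  have spF: "space (F t) = space M" for t using subalg[of t] by (simp add: subalgebra_def)
  have FF: "u \<in> borel_measurable (F t) \<Longrightarrow> u \<in> borel_measurable (F (Suc t))" for u :: "'a \<Rightarrow> real" and t
    using mono[of t] by (auto simp: measurable_def spF)
  have dM [measurable]: "d t \<in> borel_measurable M" for t
    by (rule measurable_from_subalg[OF subalg meas])
  \<comment> \<open>The process of partial sums, frozen from its first exit from \<open>(-\<eta>, \<eta>)\<close> on.\<close>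
  define X where "X \<omega> = rec_nat 0 (\<lambda>t x. x + (if \<bar>x\<bar> < \<eta> then d t \<omega> else 0))" for \<omega>
  define i where "i t \<omega> = (if \<bar>X \<omega> t\<bar> < \<eta> then 1 else 0 :: real)" for t \<omega>
  have X0: "X \<omega> 0 = 0" and XS: "X \<omega> (Suc t) = X \<omega> t + i t \<omega> * d t \<omega>" for \<omega> t
    by (simp_all add: X_def i_def)
  have XF: "(\<lambda>\<omega>. X \<omega> t) \<in> borel_measurable (F t)" for t
  proof (induction t)
    case (Suc t)
    note [measurable] = FF[OF Suc] meas[of t]
    show ?case unfolding XS i_def by measurable
  qed (simp add: X0)
  have XM [measurable]: "(\<lambda>\<omega>. X \<omega> t) \<in> borel_measurable M" for t
    by (rule measurable_from_subalg[OF subalg XF])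
  have iF: "i t \<in> borel_measurable (F t)" for t
    unfolding i_def using XF[of t] by measurable
  have iM [measurable]: "i t \<in> borel_measurable M" for t
    by (rule measurable_from_subalg[OF subalg iF])
  have i01: "\<bar>i t \<omega>\<bar> \<le> 1" "(i t \<omega>)\<^sup>2 \<le> 1" for t \<omega> by (auto simp: i_def)
  have Xb: "\<bar>X \<omega> t\<bar> \<le> real t * B" if "\<omega> \<in> space M" for t \<omega>
  proof (induction t)
    case (Suc t)
    have "\<bar>i t \<omega> * d t \<omega>\<bar> \<le> 1 * B"
      unfolding abs_mult using i01 bdd[OF that] by (intro mult_mono) auto
    thus ?case unfolding XS using Suc by (simp add: algebra_simps)
  qed (simp add: X0)
  have sqb: "(x::real)\<^sup>2 \<le> C\<^sup>2" if "\<bar>x\<bar> \<le> C" for x C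
    using power_mono[OF that, of 2] by simp
  \<comment> \<open>In the expanded square the cross term is \<open>d t\<close> times a bounded
    \<open>F t\<close>-measurable function, so \<open>orth\<close> removes it; the other new term is
    at most the square of \<open>d t\<close>.\<close>
  have E: "expectation (\<lambda>\<omega>. (X \<omega> t)\<^sup>2) \<le> (\<Sum>s<t. expectation (\<lambda>\<omega>. (d s \<omega>)\<^sup>2))" for t
  proof (induction t)
    case (Suc t)
    have i1: "integrable M (\<lambda>\<omega>. (X \<omega> t)\<^sup>2)"
      by (rule integrable_bounded[where K = "(real t * B)\<^sup>2"]) (use sqb[OF Xb] in auto)
    have i3: "integrable M (\<lambda>\<omega>. (d t \<omega>)\<^sup>2)"
      by (rule integrable_bounded[where K = "B\<^sup>2"]) (use sqb[OF bdd] in auto)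
    have b2: "\<bar>2 * X \<omega> t * i t \<omega>\<bar> \<le> 2 * (real t * B) * 1" if "\<omega> \<in> space M" for \<omega>
      unfolding abs_mult using Xb[OF that, of t] i01 by (intro mult_mono) auto
    have i2: "integrable M (\<lambda>\<omega>. (2 * X \<omega> t * i t \<omega>) * d t \<omega>)"
    proof (rule integrable_bounded[where K = "2 * (real t * B) * 1 * B"])
      fix \<omega> assume w: "\<omega> \<in> space M"
      show "\<bar>(2 * X \<omega> t * i t \<omega>) * d t \<omega>\<bar> \<le> 2 * (real t * B) * 1 * B"
        unfolding abs_mult[of _ "d t \<omega>"] using b2[OF w] bdd[OF w, of t] abs_ge_zero
        by (intro mult_mono) (auto intro: order_trans)
    qed measurable
    have "expectation (\<lambda>\<omega>. (2 * X \<omega> t * i t \<omega>) * d t \<omega>) = 0"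
      by (rule orth[OF _ b2]) (use XF iF in measurable)
    moreover have "expectation (\<lambda>\<omega>. (X \<omega> (Suc t))\<^sup>2)
        \<le> expectation (\<lambda>\<omega>. (X \<omega> t)\<^sup>2 + (2 * X \<omega> t * i t \<omega>) * d t \<omega> + (d t \<omega>)\<^sup>2)"
    proof -
      have le: "(X \<omega> (Suc t))\<^sup>2 \<le> (X \<omega> t)\<^sup>2 + (2 * X \<omega> t * i t \<omega>) * d t \<omega> + (d t \<omega>)\<^sup>2" for \<omega>
        using mult_right_mono[OF i01(2)[of t \<omega>], of "(d t \<omega>)\<^sup>2"]
        unfolding XS power2_sum by (simp add: power_mult_distrib algebra_simps)
      show ?thesis
        by (rule integral_mono'[OF _ le order_trans[OF zero_le_power2 le]]) (use i1 i2 i3 in auto)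
    qed
    ultimately show ?case using Suc i1 i2 i3 by simp
  qed (simp add: X0)
  have frozen: "X \<omega> (j + l) = X \<omega> j" if "\<eta> \<le> \<bar>X \<omega> j\<bar>" for \<omega> j l
    using that by (induction l) (simp_all add: XS i_def)
  have before: "X \<omega> j = (\<Sum>t<j. d t \<omega>)" if "\<And>s. s < j \<Longrightarrow> \<bar>X \<omega> s\<bar> < \<eta>" for \<omega> j
    using that
  proof (induction j)
    case (Suc j)
    thus ?case using Suc.prems[of j] by (simp add: XS i_def)
  qed (simp add: X0)
  \<comment> \<open>If \<open>X\<close> had not left the interval by time \<open>j\<close>, it would
    equal the partial sum at \<open>j\<close>, which lies outside. So it has left, and it keeps that
    value up to \<open>N\<close>.\<close>
  have cross: "\<eta> \<le> \<bar>X \<omega> N\<bar>" if "j \<le> N" "\<eta> \<le> \<bar>\<Sum>t<j. d t \<omega>\<bar>" for \<omega> j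
  proof -
    have "\<exists>s\<le>j. \<eta> \<le> \<bar>X \<omega> s\<bar>"
    proof (rule ccontr)
      assume "\<not> ?thesis"
      hence "\<bar>X \<omega> s\<bar> < \<eta>" if "s \<le> j" for s using that by auto
      thus False using before[of j \<omega>] that(2) by (metis less_imp_le linorder_not_le order_refl)
    qed
    then obtain s where "s \<le> j" "\<eta> \<le> \<bar>X \<omega> s\<bar>" by auto
    with frozen[of \<omega> s "N - s"] that show ?thesis by simp
  qed
  have "prob {\<omega>\<in>space M. \<exists>j\<le>N. \<eta> \<le> \<bar>\<Sum>t<j. d t \<omega>\<bar>} \<le> prob {\<omega>\<in>space M. \<eta>\<^sup>2 \<le> (X \<omega> N)\<^sup>2}"
  proof (rule finite_measure_mono)
    show "{\<omega>\<in>space M. \<exists>j\<le>N. \<eta> \<le> \<bar>\<Sum>t<j. d t \<omega>\<bar>} \<subseteq> {\<omega>\<in>space M. \<eta>\<^sup>2 \<le> (X \<omega> N)\<^sup>2}"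
      using cross \<eta> by (auto simp: abs_le_square_iff[symmetric])
  qed measurable
  also have "\<dots> \<le> expectation (\<lambda>\<omega>. (X \<omega> N)\<^sup>2) / \<eta>\<^sup>2"
  proof (rule integral_Markov_inequality_measure[where A = "{}"])
    show "integrable M (\<lambda>\<omega>. (X \<omega> N)\<^sup>2)"
      by (rule integrable_bounded[where K = "(real N * B)\<^sup>2"]) (use sqb[OF Xb] in auto)
  qed (use \<eta> in auto)
  also have "\<dots> \<le> (\<Sum>t<N. expectation (\<lambda>\<omega>. (d t \<omega>)\<^sup>2)) / \<eta>\<^sup>2"
    by (rule divide_right_mono[OF E]) simp
  finally show ?thesis .
qed

text \<open>Applied to the series started at \<open>m\<close>, the maximal inequality bounds the
  probability that the partial sums ever move by \<open>\<eta>\<close> after \<open>m\<close> by a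
  tail of the variance sum. Since the tails vanish, almost every path has a suitable
  \<open>m\<close> for each of countably many \<open>\<eta>\<close>, which is the Cauchy
  property.\<close>

theorem martingale_difference_series_converges:
  fixes d :: "nat \<Rightarrow> 'a \<Rightarrow> real"
  assumes subalg: "\<And>t. subalgebra M (F t)"
    and mono: "\<And>t. sets (F t) \<subseteq> sets (F (Suc t))"
    and meas: "\<And>t. d t \<in> borel_measurable (F (Suc t))"
    and bdd: "\<And>t \<omega>. \<omega> \<in> space M \<Longrightarrow> \<bar>d t \<omega>\<bar> \<le> B"
    and orth: "\<And>t Y C. Y \<in> borel_measurable (F t) \<Longrightarrow> (\<And>\<omega>. \<omega> \<in> space M \<Longrightarrow> \<bar>Y \<omega>\<bar> \<le> C) \<Longrightarrow>
                 expectation (\<lambda>\<omega>. Y \<omega> * d t \<omega>) = 0"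
    and summ: "summable (\<lambda>t. expectation (\<lambda>\<omega>. (d t \<omega>)\<^sup>2))"
  shows "AE \<omega> in M. convergent (\<lambda>N. \<Sum>t<N. d t \<omega>)"
proof -
  define v where "v t = expectation (\<lambda>\<omega>. (d t \<omega>)\<^sup>2)" for t
  have v0: "0 \<le> v t" for t by (simp add: v_def)
  have dM [measurable]: "d t \<in> borel_measurable M" for t
    by (rule measurable_from_subalg[OF subalg meas])
  define A where "A \<eta> m N = {\<omega>\<in>space M. \<exists>j\<le>N. \<eta> \<le> \<bar>\<Sum>t<j. d (m + t) \<omega>\<bar>}" for \<eta> :: real and m N :: nat
  have AM [measurable]: "A \<eta> m N \<in> sets M" for \<eta> m N unfolding A_def by measurable
  define tail where "tail m = (\<Sum>t. v (t + m))" for m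
  have A1: "prob (A \<eta> m N) \<le> tail m / \<eta>\<^sup>2" if "0 < \<eta>" for \<eta> m N
  proof -
    have "prob (A \<eta> m N) \<le> (\<Sum>t<N. v (m + t)) / \<eta>\<^sup>2"
      unfolding A_def v_def
      by (rule martingale_difference_maximal_inequality[where F = "\<lambda>t. F (m + t)" and B = B, OF subalg])
        (use mono meas bdd that in \<open>auto intro: orth\<close>)
    also have "(\<Sum>t<N. v (m + t)) \<le> tail m"
      unfolding tail_def using summ v0 unfolding v_def[symmetric]
      by (subst add.commute) (intro sum_le_suminf, auto intro: summable_ignore_initial_segment)
    finally show ?thesis by (simp add: divide_right_mono)
  qed
  have A2: "prob (\<Union>N. A \<eta> m N) \<le> tail m / \<eta>\<^sup>2" if "0 < \<eta>" for \<eta> m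
  proof -
    have "incseq (A \<eta> m)"
      by (auto simp: incseq_def A_def) (use order_trans in blast)
    moreover have "range (A \<eta> m) \<subseteq> events" by auto
    ultimately have "(\<lambda>N. prob (A \<eta> m N)) \<longlonglongrightarrow> prob (\<Union>N. A \<eta> m N)"
      by (intro finite_Lim_measure_incseq)
    thus ?thesis by (rule LIMSEQ_le_const2) (use A1[OF that] in auto)
  qed
  have tail0: "tail \<longlonglongrightarrow> 0"
    using suminf_exist_split2[OF summ] by (simp add: tail_def[abs_def] v_def)
  have null: "AE \<omega> in M. \<exists>m. \<forall>N. \<omega> \<notin> A \<eta> m N" if "0 < \<eta>" for \<eta>
  proof -
    have "prob (\<Inter>m. \<Union>N. A \<eta> m N) \<le> tail m / \<eta>\<^sup>2" for m
      by (rule order_trans[OF finite_measure_mono A2[OF that]]) auto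
    moreover have "(\<lambda>m. tail m / \<eta>\<^sup>2) \<longlonglongrightarrow> 0"
      using tail0 by (rule tendsto_divide_zero)
    ultimately have "prob (\<Inter>m. \<Union>N. A \<eta> m N) \<le> 0"
      by (intro LIMSEQ_le_const) auto
    hence "prob (\<Inter>m. \<Union>N. A \<eta> m N) = 0" using measure_nonneg by (simp add: order_antisym)
    hence "AE \<omega> in M. \<omega> \<notin> (\<Inter>m. \<Union>N. A \<eta> m N)"
      by (subst (asm) prob_eq_0) auto
    thus ?thesis by auto
  qed
  have "AE \<omega> in M. \<forall>i. \<exists>m. \<forall>N. \<omega> \<notin> A (inverse (real (Suc i))) m N"
    unfolding AE_all_countable by (intro allI null) simp
  with AE_space show ?thesis
  proof eventually_elim
    case (elim \<omega>)
    note w = elim(1) and elim = elim(2)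
    have "Cauchy (\<lambda>N. \<Sum>t<N. d t \<omega>)"
    proof (rule metric_CauchyI)
      fix e :: real assume "0 < e"
      then obtain i where i: "inverse (real (Suc i)) < e / 2"
        using reals_Archimedean[of "e / 2"] by auto
      from elim obtain m where "\<And>N. \<omega> \<notin> A (inverse (real (Suc i))) m N" by blast
      hence m: "\<bar>\<Sum>t<j. d (m + t) \<omega>\<bar> < inverse (real (Suc i))" for j
        using w unfolding A_def by (metis (mono_tags, lifting) mem_Collect_eq not_le order_refl)
      have "dist (\<Sum>t<a. d t \<omega>) (\<Sum>t<m. d t \<omega>) < e / 2" if "m \<le> a" for a
      proof -
        have "(\<Sum>t<a. d t \<omega>) = (\<Sum>t<m. d t \<omega>) + (\<Sum>t<a - m. d (m + t) \<omega>)"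
          using sum.atLeastLessThan_shift_0[of "\<lambda>t. d t \<omega>" m a] that
            sum.atLeastLessThan_concat[of 0 m a "\<lambda>t. d t \<omega>"]
          by (simp add: atLeast0LessThan add.commute)
        thus ?thesis using m[of "a - m"] i by (simp add: dist_real_def)
      qed
      thus "\<exists>m. \<forall>a\<ge>m. \<forall>b\<ge>m. dist (\<Sum>t<a. d t \<omega>) (\<Sum>t<b. d t \<omega>) < e"
        using dist_triangle_half_r by (metis dist_commute)
    qed
    thus ?case by (rule Cauchy_convergent)
  qed
qed
end

section \<open>Q-learning for a finite Bellman operator\<close>

text \<open>A finite controlled chain in sampled form: from the pair \<open>z\<close> a sample \<open>v\<close> drawn from \<open>p z\<close>
  determines the incurred cost \<open>C z v\<close> and the two pairs \<open>nxt z v b\<close> available at the next step.\<close>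

locale finite_bellman =
  fixes Z :: "'z set" and V :: "'v set" and p C :: "'z \<Rightarrow> 'v \<Rightarrow> real"
    and nxt :: "'z \<Rightarrow> 'v \<Rightarrow> bool \<Rightarrow> 'z" and \<gamma> cmax :: real
  assumes finZ: "finite Z" and finV: "finite V"
    and p_nonneg: "\<And>z v. z \<in> Z \<Longrightarrow> v \<in> V \<Longrightarrow> 0 \<le> p z v"
    and p_sum: "\<And>z. z \<in> Z \<Longrightarrow> (\<Sum>v\<in>V. p z v) = 1"
    and nxt_in: "\<And>z v b. z \<in> Z \<Longrightarrow> v \<in> V \<Longrightarrow> nxt z v b \<in> Z"
    and C_bounds: "\<And>z v. 0 \<le> C z v" "\<And>z v. C z v \<le> cmax"
    and \<gamma>: "0 < \<gamma>" "\<gamma> < 1"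
begin

definition target :: "('z \<Rightarrow> real) \<Rightarrow> 'z \<Rightarrow> 'v \<Rightarrow> real" where
  "target Q z v = C z v + \<gamma> * min (Q (nxt z v False)) (Q (nxt z v True))"

definition bellman :: "('z \<Rightarrow> real) \<Rightarrow> 'z \<Rightarrow> real" where
  "bellman Q z = (\<Sum>v\<in>V. p z v * target Q z v)"

text \<open>The discounted cost of paying \<open>cmax\<close> forever, and the fixed point of
  \<open>B \<mapsto> cmax + \<gamma> * B\<close>; hence targets and the Bellman operator preserve
  the range from 0 to \<open>vmax\<close>.\<close>

definition vmax :: real where "vmax = cmax / (1 - \<gamma>)"

lemma cmax_nonneg: "0 \<le> cmax"
  using C_bounds order_trans by blast

lemma vmax_nonneg: "0 \<le> vmax"
  using cmax_nonneg \<gamma> by (simp add: vmax_def)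

lemma vmax_eq: "cmax + \<gamma> * vmax = vmax"
  using \<gamma> by (simp add: vmax_def field_simps)

lemma target_diff_le:
  assumes "z \<in> Z" "v \<in> V" "\<And>z'. z' \<in> Z \<Longrightarrow> \<bar>Q z' - Q' z'\<bar> \<le> B"
  shows "\<bar>target Q z v - target Q' z v\<bar> \<le> \<gamma> * B"
proof -
  have "target Q z v - target Q' z v =
      \<gamma> * (min (Q (nxt z v False)) (Q (nxt z v True)) - min (Q' (nxt z v False)) (Q' (nxt z v True)))"
    by (simp add: target_def algebra_simps)
  also have "\<bar>\<dots>\<bar> \<le> \<gamma> * B"
    unfolding abs_mult using \<gamma> assms(3)[OF nxt_in[OF assms(1,2), of False]] assms(3)[OF nxt_in[OF assms(1,2), of True]]
    by (simp add: abs_le_iff min_def)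
  finally show ?thesis .
qed

lemma bellman_diff_le:
  assumes "z \<in> Z" "\<And>z'. z' \<in> Z \<Longrightarrow> \<bar>Q z' - Q' z'\<bar> \<le> B"
  shows "\<bar>bellman Q z - bellman Q' z\<bar> \<le> \<gamma> * B"
proof -
  have "\<bar>bellman Q z - bellman Q' z\<bar> = \<bar>\<Sum>v\<in>V. p z v * (target Q z v - target Q' z v)\<bar>"
    by (simp add: bellman_def sum_subtractf algebra_simps)
  also have "\<dots> \<le> (\<Sum>v\<in>V. \<bar>p z v * (target Q z v - target Q' z v)\<bar>)"
    by (rule sum_abs)
  also have "\<dots> \<le> (\<Sum>v\<in>V. p z v * (\<gamma> * B))"
    unfolding abs_mult using p_nonneg[OF assms(1)] target_diff_le[OF assms(1) _ assms(2)]
    by (intro sum_mono mult_mono) auto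
  also have "\<dots> = \<gamma> * B"
    using p_sum[OF assms(1)] by (simp flip: sum_distrib_right)
  finally show ?thesis .
qed

lemma target_cong:
  assumes "z \<in> Z" "v \<in> V" "\<And>z'. z' \<in> Z \<Longrightarrow> Q z' = Q' z'"
  shows "target Q z v = target Q' z v"
  using assms nxt_in by (simp add: target_def)

lemma target_bounds:
  assumes "z \<in> Z" "v \<in> V" "\<And>z'. z' \<in> Z \<Longrightarrow> 0 \<le> Q z' \<and> Q z' \<le> vmax"
  shows "0 \<le> target Q z v" "target Q z v \<le> vmax"
proof -
  have "0 \<le> min (Q (nxt z v False)) (Q (nxt z v True))" "min (Q (nxt z v False)) (Q (nxt z v True)) \<le> vmax"
    using assms nxt_in by (auto simp: min_def)
  note * = this
  show "0 \<le> target Q z v"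
    unfolding target_def using * \<gamma> C_bounds by simp
  have "target Q z v \<le> cmax + \<gamma> * vmax"
    unfolding target_def using * \<gamma> C_bounds by (intro add_mono mult_left_mono) auto
  thus "target Q z v \<le> vmax"
    by (simp only: vmax_eq)
qed

lemma bellman_bounds:
  assumes "z \<in> Z" "\<And>z'. z' \<in> Z \<Longrightarrow> 0 \<le> Q z' \<and> Q z' \<le> vmax"
  shows "0 \<le> bellman Q z" "bellman Q z \<le> vmax"
proof -
  show "0 \<le> bellman Q z"
    unfolding bellman_def using assms target_bounds(1)[of z _ Q] p_nonneg by (intro sum_nonneg) auto
  have "bellman Q z \<le> (\<Sum>v\<in>V. p z v * vmax)"
    unfolding bellman_def using assms target_bounds(2)[of z _ Q] p_nonneg
    by (intro sum_mono mult_left_mono) auto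
  thus "bellman Q z \<le> vmax"
    using p_sum[OF assms(1)] by (simp flip: sum_distrib_right)
qed

lemma bellman_fixed_point_unique:
  assumes "\<And>z. z \<in> Z \<Longrightarrow> Q z = bellman Q z" "\<And>z. z \<in> Z \<Longrightarrow> Q' z = bellman Q' z" "z \<in> Z"
  shows "Q z = Q' z"
proof -
  define K where "K = (\<Sum>z\<in>Z. \<bar>Q z - Q' z\<bar>)"
  have *: "\<bar>Q z - Q' z\<bar> \<le> \<gamma> ^ j * K" if "z \<in> Z" for j z
    using that
  proof (induction j arbitrary: z)
    case 0
    thus ?case using finZ by (auto simp: K_def intro!: member_le_sum)
  next
    case (Suc j)
    have "\<bar>bellman Q z - bellman Q' z\<bar> \<le> \<gamma> * (\<gamma> ^ j * K)"
      by (rule bellman_diff_le[OF Suc.prems Suc.IH])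
    thus ?case using assms(1,2)[OF Suc.prems] by (simp add: mult.assoc)
  qed
  have "(\<lambda>j. \<gamma> ^ j * K) \<longlonglongrightarrow> 0"
    using \<gamma> by (intro tendsto_mult_left_zero LIMSEQ_power_zero) auto
  hence "\<bar>Q z - Q' z\<bar> \<le> 0"
    by (rule LIMSEQ_le_const) (use *[OF assms(3)] in auto)
  thus ?thesis by simp
qed

text \<open>Picard iteration from 0: increments shrink geometrically, and the bounds pass to the
  limit. The value 0 outside \<open>Z\<close> matches the normalisation under which
  \<open>Qstar\<close> is a definite description.\<close>

lemma bellman_fixed_point_exists:
  obtains Q where "\<And>z. z \<notin> Z \<Longrightarrow> Q z = 0" "\<And>z. z \<in> Z \<Longrightarrow> Q z = bellman Q z"
    "\<And>z. z \<in> Z \<Longrightarrow> 0 \<le> Q z" "\<And>z. z \<in> Z \<Longrightarrow> Q z \<le> vmax"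
proof -
  define r where "r j = ((\<lambda>Q z. if z \<in> Z then bellman Q z else 0) ^^ j) (\<lambda>_. 0)" for j
  have r0: "r 0 z = 0" and rS: "r (Suc j) z = (if z \<in> Z then bellman (r j) z else 0)" for z j
    by (simp_all add: r_def)
  have rb: "0 \<le> r j z \<and> r j z \<le> vmax" if "z \<in> Z" for j z
    using that by (induction j arbitrary: z) (auto simp: r0 rS vmax_nonneg bellman_bounds)
  have rd: "\<bar>r (Suc j) z - r j z\<bar> \<le> \<gamma> ^ j * vmax" if "z \<in> Z" for j z
    using that
  proof (induction j arbitrary: z)
    case 0
    thus ?case using rb[of z 1] by (simp add: r0)
  next
    case (Suc j)
    from bellman_diff_le[OF Suc.prems Suc.IH] Suc.prems show ?case
      unfolding rS by (simp add: mult.assoc flip: rS)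
  qed
  have conv: "convergent (\<lambda>j. r j z)" for z
  proof (cases "z \<in> Z")
    case True
    have "summable (\<lambda>j. r (Suc j) z - r j z)"
      by (rule summable_comparison_test'[where g = "\<lambda>j. \<gamma> ^ j * vmax" and N = 0])
        (use \<gamma> rd[OF True] in \<open>auto intro!: summable_mult2 summable_geometric\<close>)
    from summable_LIMSEQ[OF this] show ?thesis
      unfolding sum_lessThan_telescope[of "\<lambda>j. r j z"] by (auto simp: r0 convergent_def)
  next
    case False
    hence "r j z = 0" for j by (cases j) (auto simp: r0 rS)
    thus ?thesis by (simp add: convergent_const)
  qed
  define Q where "Q z = lim (\<lambda>j. r j z)" for z
  have lim: "(\<lambda>j. r j z) \<longlonglongrightarrow> Q z" for z
    using conv by (simp add: Q_def convergent_LIMSEQ_iff)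
  have limS: "(\<lambda>j. r (Suc j) z) \<longlonglongrightarrow> Q z" for z
    using lim by (rule LIMSEQ_Suc)
  show thesis
  proof (rule that[of Q])
    show "Q z = 0" if "z \<notin> Z" for z
      using limS[of z] that by (simp add: rS LIMSEQ_const_iff)
    show "0 \<le> Q z" if "z \<in> Z" for z
      using lim[of z] by (rule LIMSEQ_le_const) (use rb[OF that] in auto)
    show "Q z \<le> vmax" if "z \<in> Z" for z
      using lim[of z] by (rule LIMSEQ_le_const2) (use rb[OF that] in auto)
    show "Q z = bellman Q z" if "z \<in> Z" for z
    proof (rule LIMSEQ_unique[OF limS])
      show "(\<lambda>j. r (Suc j) z) \<longlonglongrightarrow> bellman Q z"
        unfolding rS bellman_def target_def using that by (auto intro!: tendsto_intros lim)
    qed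
  qed
qed

text \<open>\<open>law\<close> is the conditional law of the sample given \<open>F t\<close>,
  written on events. It is required for each pair separately, because each pair's noise series is
  treated on its own; a pair not updated at time \<open>t\<close> has step size 0.\<close>

theorem q_learning_converges:
  fixes \<xi> :: "nat \<Rightarrow> 'z \<Rightarrow> 'om \<Rightarrow> 'v" and \<alpha> Q :: "nat \<Rightarrow> 'z \<Rightarrow> 'om \<Rightarrow> real"
  assumes M: "prob_space M"
    and subalg: "\<And>t. subalgebra M (F t)"
    and mono: "\<And>t. sets (F t) \<subseteq> sets (F (Suc t))"
    and \<alpha>F: "\<And>t z. z \<in> Z \<Longrightarrow> \<alpha> t z \<in> borel_measurable (F t)"
    and \<alpha>: "\<And>t z \<omega>. z \<in> Z \<Longrightarrow> \<omega> \<in> space M \<Longrightarrow> 0 \<le> \<alpha> t z \<omega>"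
      "\<And>t z \<omega>. z \<in> Z \<Longrightarrow> \<omega> \<in> space M \<Longrightarrow> \<alpha> t z \<omega> \<le> 1"
    and \<xi>F: "\<And>t z v. z \<in> Z \<Longrightarrow> {\<omega>\<in>space M. \<xi> t z \<omega> = v} \<in> sets (F (Suc t))"
    and law: "\<And>t z v E. z \<in> Z \<Longrightarrow> v \<in> V \<Longrightarrow> E \<in> sets (F t) \<Longrightarrow>
        measure M (E \<inter> {\<omega>\<in>space M. \<xi> t z \<omega> = v}) = measure M E * p z v"
    and div: "\<And>z. z \<in> Z \<Longrightarrow> AE \<omega> in M. filterlim (\<lambda>N. \<Sum>t<N. \<alpha> t z \<omega>) at_top sequentially"
    and sq: "\<And>z. z \<in> Z \<Longrightarrow> AE \<omega> in M. summable (\<lambda>t. (\<alpha> t z \<omega>)\<^sup>2)"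
    and Q0: "\<And>z \<omega>. z \<in> Z \<Longrightarrow> Q 0 z \<omega> = 0"
    and QS: "\<And>t z \<omega>. z \<in> Z \<Longrightarrow> \<xi> t z \<omega> \<in> V \<Longrightarrow>
        Q (Suc t) z \<omega> = (1 - \<alpha> t z \<omega>) * Q t z \<omega> + \<alpha> t z \<omega> * target (\<lambda>z'. Q t z' \<omega>) z (\<xi> t z \<omega>)"
    and fixed: "\<And>z. z \<in> Z \<Longrightarrow> Qs z = bellman Qs z"
    and z: "z \<in> Z"
  shows "AE \<omega> in M. (\<lambda>t. Q t z \<omega>) \<longlonglongrightarrow> Qs z"
proof -
  interpret prob_space M by fact
  have spF: "space (F t) = space M" for t using subalg[of t] by (simp add: subalgebra_def)
  have FF: "u \<in> borel_measurable (F t) \<Longrightarrow> u \<in> borel_measurable (F (Suc t))" for u :: "'om \<Rightarrow> real" and t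
    using mono[of t] by (auto simp: measurable_def spF)
  have FM: "u \<in> borel_measurable (F t) \<Longrightarrow> u \<in> borel_measurable M" for u :: "'om \<Rightarrow> real" and t
    by (rule measurable_from_subalg[OF subalg])
  have FFs: "sets (F s) \<subseteq> sets (F t)" if "s \<le> t" for s t
    using lift_Suc_mono_le[of "\<lambda>t. sets (F t)", OF mono that] .
  have FFle: "u \<in> borel_measurable (F s) \<Longrightarrow> s \<le> t \<Longrightarrow> u \<in> borel_measurable (F t)" for u :: "'om \<Rightarrow> real" and s t
    using FFs[of s t] by (auto simp: measurable_def spF)
  \<comment> \<open>Indicators of the finitely many outcomes turn the sampled target into a finite
    sum, so measurability and conditional means are needed only for the events
    \<open>\<xi> t z \<omega> = v\<close>.\<close>
  define I where "I t z v \<omega> = (if \<xi> t z \<omega> = v then 1 else 0 :: real)" for t z v \<omega>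
  have IF: "I t z v \<in> borel_measurable (F (Suc t))" if "z \<in> Z" for t z v
    unfolding I_def using \<xi>F[OF that, of t v] by (intro measurable_If) (auto simp: spF)
  have sumI: "(\<Sum>v\<in>V. I t z v \<omega> * u v) = (if \<xi> t z \<omega> \<in> V then u (\<xi> t z \<omega>) else 0)" for t z \<omega> and u :: "'v \<Rightarrow> real"
    using finV by (auto simp: I_def if_distrib[of "\<lambda>x. x * _"] sum.delta' cong: if_cong)

  \<comment> \<open>A copy of the iterates that ignores samples outside \<^term>\<open>V\<close>; it is adapted to the filtration,
    which the iterates themselves need not be on a null set.\<close>
  define R where "R \<omega> = rec_nat (\<lambda>z. 0) (\<lambda>t r z. (1 - \<alpha> t z \<omega>) * r z +
      \<alpha> t z \<omega> * (\<Sum>v\<in>V. I t z v \<omega> * target r z v))" for \<omega>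
  have R0: "R \<omega> 0 z = 0" and RS: "R \<omega> (Suc t) z = (1 - \<alpha> t z \<omega>) * R \<omega> t z +
      \<alpha> t z \<omega> * (\<Sum>v\<in>V. I t z v \<omega> * target (R \<omega> t) z v)" for \<omega> t z
    by (simp_all add: R_def)
  have RF: "(\<lambda>\<omega>. R \<omega> t z) \<in> borel_measurable (F t)" if "z \<in> Z" for t z
    using that
  proof (induction t arbitrary: z)
    case (Suc t)
    note [measurable] = FF[OF Suc.IH] FF[OF \<alpha>F] IF
    have [measurable]: "(\<lambda>\<omega>. target (R \<omega> t) z v) \<in> borel_measurable (F (Suc t))" if "v \<in> V" for v
      unfolding target_def using nxt_in[OF Suc.prems that] by measurable
    show ?case unfolding RS using Suc.prems by measurable
  qed (simp add: R0)
  have TF: "(\<lambda>\<omega>. target (R \<omega> t) z v) \<in> borel_measurable (F t)" if "z \<in> Z" "v \<in> V" for t z v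
    unfolding target_def using RF[OF nxt_in[OF that], of t] by measurable
  \<comment> \<open>The convex-combination bound; the sum over \<open>V\<close> is either a target
    or 0, and both lie in the range.\<close>
  have Rb: "0 \<le> R \<omega> t z \<and> R \<omega> t z \<le> vmax" if "z \<in> Z" "\<omega> \<in> space M" for \<omega> t z
    using that(1)
  proof (induction t arbitrary: z)
    case (Suc t)
    note a = \<alpha>[OF Suc.prems that(2), of t]
    have s: "0 \<le> (\<Sum>v\<in>V. I t z v \<omega> * target (R \<omega> t) z v)" "(\<Sum>v\<in>V. I t z v \<omega> * target (R \<omega> t) z v) \<le> vmax"
      unfolding sumI using target_bounds[OF Suc.prems _ Suc.IH] vmax_nonneg by auto
    have "R \<omega> (Suc t) z \<le> (1 - \<alpha> t z \<omega>) * vmax + \<alpha> t z \<omega> * vmax"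
      unfolding RS using s Suc a by (intro add_mono mult_left_mono) auto
    moreover have "0 \<le> R \<omega> (Suc t) z"
      unfolding RS using s Suc a by (intro add_nonneg_nonneg mult_nonneg_nonneg) auto
    ultimately show ?case by (simp add: algebra_simps)
  qed (simp add: R0 vmax_nonneg)

  \<comment> \<open>The sampled target minus its mean under \<open>p z\<close>. Both terms lie
    between 0 and \<open>vmax\<close>, so the difference is at most \<open>vmax\<close> in absolute
    value, without a factor 2.\<close>
  define w where "w t z \<omega> = (\<Sum>v\<in>V. (I t z v \<omega> - p z v) * target (R \<omega> t) z v)" for t z \<omega>
  have w_eq: "w t z \<omega> = (\<Sum>v\<in>V. I t z v \<omega> * target (R \<omega> t) z v) - bellman (R \<omega> t) z" for t z \<omega>
    by (simp add: w_def bellman_def sum_subtractf algebra_simps)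
  have wF: "w t z \<in> borel_measurable (F (Suc t))" if "z \<in> Z" for t z
    unfolding w_def using IF[OF that] FF[OF TF[OF that]] by measurable
  have wb: "\<bar>w t z \<omega>\<bar> \<le> vmax" if "z \<in> Z" "\<omega> \<in> space M" for t z \<omega>
  proof -
    have "0 \<le> (\<Sum>v\<in>V. I t z v \<omega> * target (R \<omega> t) z v)" "(\<Sum>v\<in>V. I t z v \<omega> * target (R \<omega> t) z v) \<le> vmax"
      unfolding sumI using target_bounds[OF that(1) _ Rb[OF _ that(2)]] vmax_nonneg by auto
    with bellman_bounds[of z "R \<omega> t", OF that(1) Rb[OF _ that(2)]] show ?thesis unfolding w_eq by auto
  qed

  \<comment> \<open>Passes from events to bounded \<open>F t\<close>-measurable factors: the
    conditional expectation of the indicator is the constant \<open>p z v\<close>.\<close>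
  have cond: "expectation (\<lambda>\<omega>. Y \<omega> * I t z v \<omega>) = expectation Y * p z v"
    if zv: "z \<in> Z" "v \<in> V" and Y: "Y \<in> borel_measurable (F t)" and Yb: "\<And>\<omega>. \<omega> \<in> space M \<Longrightarrow> \<bar>Y \<omega>\<bar> \<le> B"
    for t z v Y and B :: real
  proof -
    interpret S: finite_measure_subalgebra M "F t"
      by unfold_locales (rule subalg)
    have IM: "I t z v \<in> borel_measurable M" by (rule FM[OF IF[OF zv(1)]])
    have Iint: "integrable M (I t z v)"
      by (rule integrable_bounded[OF IM, of 1]) (simp add: I_def)
    have ce: "AE \<omega> in M. real_cond_exp M (F t) (I t z v) \<omega> = p z v"
    proof (rule S.real_cond_exp_charact[OF _ Iint])
      fix A assume A: "A \<in> sets (F t)"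
      hence AM: "A \<in> sets M" using subalg[of t] by (auto simp: subalgebra_def)
      let ?B = "{\<omega>\<in>space M. \<xi> t z \<omega> = v}"
      have BM: "?B \<in> sets M" using \<xi>F[OF zv(1), of t v] subalg[of "Suc t"] by (auto simp: subalgebra_def)
      have "(\<integral>\<omega>\<in>A. I t z v \<omega> \<partial>M) = (\<integral>\<omega>. indicator (A \<inter> ?B) \<omega> \<partial>M)"
        unfolding set_lebesgue_integral_def
        by (rule Bochner_Integration.integral_cong) (auto simp: I_def indicator_def)
      also have "\<dots> = measure M (A \<inter> ?B)" using AM BM by simp
      also have "\<dots> = (\<integral>\<omega>\<in>A. p z v \<partial>M)"
        using law[OF zv A] AM by (simp add: set_lebesgue_integral_def)
      finally show "(\<integral>\<omega>\<in>A. I t z v \<omega> \<partial>M) = (\<integral>\<omega>\<in>A. p z v \<partial>M)" .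
    qed auto
    have int: "integrable M (\<lambda>\<omega>. Y \<omega> * I t z v \<omega>)"
    proof (rule integrable_bounded[where K = "B"])
      fix \<omega> assume "\<omega> \<in> space M"
      from Yb[OF this] show "\<bar>Y \<omega> * I t z v \<omega>\<bar> \<le> B" by (auto simp: I_def)
    qed (use FM[OF Y] IM in measurable)
    have "expectation (\<lambda>\<omega>. Y \<omega> * I t z v \<omega>) = expectation (\<lambda>\<omega>. Y \<omega> * real_cond_exp M (F t) (I t z v) \<omega>)"
      using S.real_cond_exp_intg(2)[OF int Y IM] by simp
    also have "\<dots> = expectation (\<lambda>\<omega>. Y \<omega> * p z v)"
      by (rule integral_cong_AE) (use ce FM[OF Y] in auto)
    finally show ?thesis by simp
  qed
  \<comment> \<open>The target depends on the iterate at time \<open>t\<close>, hence is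
    \<open>F t\<close>-measurable and can be absorbed into the test function
    \<open>G\<close>.\<close>
  have worth: "expectation (\<lambda>\<omega>. Y \<omega> * w t z \<omega>) = 0"
    if z: "z \<in> Z" and Y: "Y \<in> borel_measurable (F t)" and Yb: "\<And>\<omega>. \<omega> \<in> space M \<Longrightarrow> \<bar>Y \<omega>\<bar> \<le> B"
    for t z Y and B :: real
  proof -
    define G where "G v \<omega> = Y \<omega> * target (R \<omega> t) z v" for v \<omega>
    have GF: "G v \<in> borel_measurable (F t)" if "v \<in> V" for v
      unfolding G_def using Y TF[OF z that] by measurable
    have Gb: "\<bar>G v \<omega>\<bar> \<le> B * vmax" if "v \<in> V" "\<omega> \<in> space M" for v \<omega>
      unfolding G_def abs_mult using Yb[OF that(2)] target_bounds[of z v "R \<omega> t", OF z that(1) Rb[OF _ that(2)]]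
      by (intro mult_mono) (auto intro: order_trans[OF abs_ge_zero])
    have Gint: "integrable M (G v)" if "v \<in> V" for v
      by (rule integrable_bounded[OF FM[OF GF[OF that]] Gb[OF that]])
    have GIint: "integrable M (\<lambda>\<omega>. G v \<omega> * I t z v \<omega>)" if "v \<in> V" for v
    proof (rule integrable_bounded[where K = "B * vmax"])
      fix \<omega> assume "\<omega> \<in> space M"
      from Gb[OF that this] show "\<bar>G v \<omega> * I t z v \<omega>\<bar> \<le> B * vmax" by (auto simp: I_def)
    qed (use FM[OF GF[OF that]] FM[OF IF[OF z]] in measurable)
    have "expectation (\<lambda>\<omega>. Y \<omega> * w t z \<omega>) = expectation (\<lambda>\<omega>. \<Sum>v\<in>V. G v \<omega> * I t z v \<omega> - G v \<omega> * p z v)"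
      by (simp add: w_def G_def sum_distrib_left algebra_simps)
    also have "\<dots> = (\<Sum>v\<in>V. expectation (\<lambda>\<omega>. G v \<omega> * I t z v \<omega>) - expectation (\<lambda>\<omega>. G v \<omega> * p z v))"
      using Gint GIint by (subst Bochner_Integration.integral_sum) auto
    also have "\<dots> = 0"
      using cond[OF z _ GF Gb] by (intro sum.neutral) auto
    finally show ?thesis .
  qed

  \<comment> \<open>Since \<open>\<Sum>\<alpha>\<^sup>2\<close> is finite only almost surely, the step sizes are cut off once this sum exceeds \<open>L\<close>.\<close>
  define \<beta> where "\<beta> L t z \<omega> = \<alpha> t z \<omega> * (if (\<Sum>s\<le>t. (\<alpha> s z \<omega>)\<^sup>2) \<le> real L then 1 else 0)" for L t z \<omega>
  have \<beta>F: "\<beta> L t z \<in> borel_measurable (F t)" if "z \<in> Z" for L t z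
  proof -
    have [measurable]: "\<alpha> s z \<in> borel_measurable (F t)" if "s \<in> {..t}" for s
      using FFle[OF \<alpha>F[OF \<open>z \<in> Z\<close>], of s t] that by simp
    have [measurable]: "\<alpha> t z \<in> borel_measurable (F t)" by (rule \<alpha>F[OF that])
    show ?thesis unfolding \<beta>_def by measurable
  qed
  have \<beta>b: "\<bar>\<beta> L t z \<omega>\<bar> \<le> 1" if "z \<in> Z" "\<omega> \<in> space M" for L t z \<omega>
    using \<alpha>[OF that, of t] by (simp add: \<beta>_def)
  \<comment> \<open>The test in \<open>\<beta>\<close> includes the step at time \<open>t\<close>
    itself, which \<open>F t\<close> already knows. So the accumulated squares never overshoot
    \<open>L\<close>, even by one term.\<close>
  have \<beta>sum: "(\<Sum>t<N. (\<beta> L t z \<omega>)\<^sup>2) \<le> real L" for L N z \<omega>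
  proof (induction N)
    case (Suc N)
    show ?case
    proof (cases "(\<Sum>s\<le>N. (\<alpha> s z \<omega>)\<^sup>2) \<le> real L")
      case True
      have "(\<Sum>t<Suc N. (\<beta> L t z \<omega>)\<^sup>2) \<le> (\<Sum>t<Suc N. (\<alpha> t z \<omega>)\<^sup>2)"
        by (rule sum_mono) (simp add: \<beta>_def)
      also have "\<dots> \<le> real L" using True by (simp add: lessThan_Suc_atMost)
      finally show ?thesis .
    qed (use Suc in \<open>simp add: \<beta>_def\<close>)
  qed simp
  have cut: "AE \<omega> in M. convergent (\<lambda>N. \<Sum>t<N. \<beta> L t z \<omega> * w t z \<omega>)" if z: "z \<in> Z" for L z
  proof (rule martingale_difference_series_converges[where F = F and B = vmax, OF subalg mono])
    note \<beta>M = FM[OF \<beta>F[OF z]] and wM = FM[OF wF[OF z]]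
    show "(\<lambda>\<omega>. \<beta> L t z \<omega> * w t z \<omega>) \<in> borel_measurable (F (Suc t))" for t
      using FF[OF \<beta>F[OF z]] wF[OF z] by measurable
    show "\<bar>\<beta> L t z \<omega> * w t z \<omega>\<bar> \<le> vmax" if "\<omega> \<in> space M" for t \<omega>
      using mult_mono[OF \<beta>b[OF z that, of L t] wb[OF z that, of t]] by (simp add: abs_mult)
    show "expectation (\<lambda>\<omega>. Y \<omega> * (\<beta> L t z \<omega> * w t z \<omega>)) = 0"
      if Y: "Y \<in> borel_measurable (F t)" "\<And>\<omega>. \<omega> \<in> space M \<Longrightarrow> \<bar>Y \<omega>\<bar> \<le> B" for Y t and B :: real
    proof -
      have "(\<lambda>\<omega>. Y \<omega> * \<beta> L t z \<omega>) \<in> borel_measurable (F t)"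
        using Y(1) \<beta>F[OF z] by measurable
      moreover have "\<bar>Y \<omega> * \<beta> L t z \<omega>\<bar> \<le> B" if "\<omega> \<in> space M" for \<omega>
        using mult_mono[OF Y(2)[OF that] \<beta>b[OF z that, of L t]] Y(2)[OF that] by (simp add: abs_mult)
      ultimately show ?thesis using worth[OF z, of "\<lambda>\<omega>. Y \<omega> * \<beta> L t z \<omega>" t B] by (simp add: mult.assoc)
    qed
    have i1: "integrable M (\<lambda>\<omega>. (\<beta> L t z \<omega>)\<^sup>2)" for t
      by (rule integrable_bounded[where K = "1"]) (use \<beta>M \<beta>b[OF z] in \<open>auto simp: abs_square_le_1\<close>)
    show "summable (\<lambda>t. expectation (\<lambda>\<omega>. (\<beta> L t z \<omega> * w t z \<omega>)\<^sup>2))"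
    proof (rule summableI_nonneg_bounded)
      fix N
      have "(\<Sum>t<N. expectation (\<lambda>\<omega>. (\<beta> L t z \<omega> * w t z \<omega>)\<^sup>2)) \<le> (\<Sum>t<N. expectation (\<lambda>\<omega>. (\<beta> L t z \<omega>)\<^sup>2 * vmax\<^sup>2))"
      proof (intro sum_mono integral_mono')
        fix t \<omega> assume "\<omega> \<in> space M"
        from power_mono[OF wb[OF z this, of t], of 2]
        show "(\<beta> L t z \<omega> * w t z \<omega>)\<^sup>2 \<le> (\<beta> L t z \<omega>)\<^sup>2 * vmax\<^sup>2"
          by (simp add: power_mult_distrib mult_left_mono)
      qed (use i1 in auto)
      also have "\<dots> = expectation (\<lambda>\<omega>. \<Sum>t<N. (\<beta> L t z \<omega>)\<^sup>2) * vmax\<^sup>2"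
        using i1 by (simp add: Bochner_Integration.integral_sum sum_distrib_right)
      also have "\<dots> \<le> expectation (\<lambda>\<omega>. real L) * vmax\<^sup>2"
        by (intro mult_right_mono integral_mono) (use i1 \<beta>sum in auto)
      finally show "(\<Sum>t<N. expectation (\<lambda>\<omega>. (\<beta> L t z \<omega> * w t z \<omega>)\<^sup>2)) \<le> real L * vmax\<^sup>2"
        by (simp add: prob_space)
    qed simp
  qed
  have conv: "AE \<omega> in M. convergent (\<lambda>N. \<Sum>t<N. \<alpha> t z \<omega> * w t z \<omega>)" if z: "z \<in> Z" for z
  proof -
    \<comment> \<open>The level \<open>L\<close> that makes the cut-off inactive depends on the
      path, so one null set has to serve all \<open>L\<close>.\<close>
    have "AE \<omega> in M. \<forall>L. convergent (\<lambda>N. \<Sum>t<N. \<beta> L t z \<omega> * w t z \<omega>)"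
      unfolding AE_all_countable using cut[OF z] by blast
    with sq[OF z] show ?thesis
    proof eventually_elim
      case (elim \<omega>)
      obtain L where L: "(\<Sum>t. (\<alpha> t z \<omega>)\<^sup>2) \<le> real L" using real_arch_simple by blast
      have "(\<Sum>s\<le>t. (\<alpha> s z \<omega>)\<^sup>2) \<le> real L" for t
        by (rule order_trans[OF sum_le_suminf[OF elim(1)] L]) auto
      hence "\<beta> L t z \<omega> = \<alpha> t z \<omega>" for t by (simp add: \<beta>_def)
      with elim(2)[rule_format, of L] show ?case by simp
    qed
  qed

  \<comment> \<open>\<open>law\<close> speaks of outcomes in \<open>V\<close> only; as
    \<open>p z\<close> has mass one there, other samples form a null set, off which the adapted copy
    and the iterates coincide.\<close>
  have inV: "AE \<omega> in M. \<xi> t z \<omega> \<in> V" if z: "z \<in> Z" for t z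
  proof -
    have ev: "{\<omega>\<in>space M. \<xi> t z \<omega> = v} \<in> events" for v
      using \<xi>F[OF z, of t v] subalg[of "Suc t"] by (auto simp: subalgebra_def)
    have eq: "{\<omega>\<in>space M. \<xi> t z \<omega> \<in> V} = (\<Union>v\<in>V. {\<omega>\<in>space M. \<xi> t z \<omega> = v})" by auto
    have "prob {\<omega>\<in>space M. \<xi> t z \<omega> \<in> V} = (\<Sum>v\<in>V. prob {\<omega>\<in>space M. \<xi> t z \<omega> = v})"
      unfolding eq using finV ev by (intro finite_measure_finite_Union) (auto simp: disjoint_family_on_def)
    also have "\<dots> = (\<Sum>v\<in>V. p z v)"
    proof (rule sum.cong[OF refl])
      fix v assume v: "v \<in> V"
      have "space M \<in> sets (F t)" using sets.top[of "F t"] by (simp add: spF)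
      from law[OF z v this] show "prob {\<omega>\<in>space M. \<xi> t z \<omega> = v} = p z v"
        by (simp add: prob_space Int_absorb1 Collect_restrict)
    qed
    finally have "prob {\<omega>\<in>space M. \<xi> t z \<omega> \<in> V} = 1" using p_sum[OF z] by simp
    thus ?thesis
      by (subst (asm) prob_Collect_eq_1) (use eq finV ev in auto)
  qed
  have "AE \<omega> in M. \<forall>z\<in>Z. \<forall>t. \<xi> t z \<omega> \<in> V"
    using inV by (intro AE_finite_allI finZ) (simp add: AE_all_countable)
  moreover have "AE \<omega> in M. \<forall>z\<in>Z. convergent (\<lambda>N. \<Sum>t<N. \<alpha> t z \<omega> * w t z \<omega>)"
    using conv by (intro AE_finite_allI finZ)
  moreover have "AE \<omega> in M. \<forall>z\<in>Z. filterlim (\<lambda>N. \<Sum>t<N. \<alpha> t z \<omega>) at_top sequentially"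
    using div by (intro AE_finite_allI finZ)
  ultimately show ?thesis using AE_space
  proof eventually_elim
    case (elim \<omega>)
    have RQ: "R \<omega> t z = Q t z \<omega>" if "z \<in> Z" for t z
      using that
    proof (induction t arbitrary: z)
      case (Suc t)
      have x: "\<xi> t z \<omega> \<in> V" using elim(1) Suc.prems by blast
      have "target (R \<omega> t) z (\<xi> t z \<omega>) = target (\<lambda>z'. Q t z' \<omega>) z (\<xi> t z \<omega>)"
        by (rule target_cong[OF Suc.prems x Suc.IH])
      with x Suc show ?case by (simp add: RS sumI QS)
    qed (simp add: R0 Q0)
    \<comment> \<open>\<open>Qs\<close> is only known to be a fixed point, so the uniform bound
      \<open>K\<close> uses the finite sum of its absolute values.\<close>
    have "(\<lambda>t. R \<omega> t z - Qs z) \<longlonglongrightarrow> 0"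
    proof (rule asynchronous_contraction_tendsto_zero[where Z = Z and \<alpha> = "\<lambda>t z. \<alpha> t z \<omega>" and w = "\<lambda>t z. w t z \<omega>"
          and D = "\<lambda>t z. R \<omega> t z - Qs z" and H = "\<lambda>t z. bellman (R \<omega> t) z - bellman Qs z"
          and K = "vmax + (\<Sum>z\<in>Z. \<bar>Qs z\<bar>)", OF finZ \<gamma>])
      show "R \<omega> (Suc t) z - Qs z = (1 - \<alpha> t z \<omega>) * (R \<omega> t z - Qs z) +
          \<alpha> t z \<omega> * (bellman (R \<omega> t) z - bellman Qs z + w t z \<omega>)" if "z \<in> Z" for t z
        unfolding RS w_eq fixed[OF that, symmetric] by (simp add: algebra_simps)
      show "\<bar>bellman (R \<omega> t) z - bellman Qs z\<bar> \<le> \<gamma> * B"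
        if "z \<in> Z" "\<And>z'. z' \<in> Z \<Longrightarrow> \<bar>R \<omega> t z' - Qs z'\<bar> \<le> B" for t z B
        by (rule bellman_diff_le[OF that])
      show "\<bar>R \<omega> t z - Qs z\<bar> \<le> vmax + (\<Sum>z\<in>Z. \<bar>Qs z\<bar>)" if "z \<in> Z" for t z
        using Rb[OF that elim(4), of t] member_le_sum[OF that, of "\<lambda>z. \<bar>Qs z\<bar>"] finZ by auto
    qed (use elim \<alpha> z in auto)
    hence "(\<lambda>t. R \<omega> t z) \<longlonglongrightarrow> Qs z" by (simp add: LIM_zero_iff)
    thus ?case by (simp add: RQ[OF z])
  qed
qed

end

section \<open>The chain of empirical distributions\<close>

lemma emp_eq_imp_mset_eq:
  assumes "length s = length s'" "emp s = emp s'"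
  shows "mset s = mset s'"
proof (cases "s = []")
  case False
  have "count_list s \<sigma> = count_list s' \<sigma>" for \<sigma>
    using fun_cong[OF assms(2), of \<sigma>] assms(1) False by (auto simp: emp_def)
  thus ?thesis by (intro multiset_eqI) (simp add: count_mset)
qed (use assms in simp)

lemma emp_mset_cong: "mset s = mset s' \<Longrightarrow> emp s = emp s'"
  unfolding emp_def by (metis count_mset mset_eq_length)

locale mean_field =
  fixes n :: nat and f :: "'s::finite \<Rightarrow> ('s \<Rightarrow> real) \<Rightarrow> 'w::finite \<Rightarrow> 's" and W :: "'w list pmf"
  assumes n_pos: "1 \<le> n" and exch: "exchangeable n W"
begin

abbreviation step :: "'s list \<Rightarrow> 'w list \<Rightarrow> 's list" where
  "step s ws \<equiv> map2 (\<lambda>si wi. f si (emp s) wi) s ws"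

lemma length_noise: "ws \<in> set_pmf W \<Longrightarrow> length ws = n"
  using exch by (simp add: exchangeable_def)

lemma length_step: "length s = n \<Longrightarrow> ws \<in> set_pmf W \<Longrightarrow> length (step s ws) = n"
  using length_noise by simp

lemma finite_Mn: "finite (Mn n :: ('s \<Rightarrow> real) set)"
proof (rule finite_subset)
  show "(Mn n :: ('s \<Rightarrow> real) set) \<subseteq> PiE UNIV (\<lambda>_. (\<lambda>j. real j / real n) ` {..n})"
    by (auto simp: Mn_def)
qed (intro finite_PiE, auto)

lemma emp_in_Mn:
  fixes s :: "'s list"
  assumes "length s = n"
  shows "emp s \<in> Mn n"
proof -
  have "(\<Sum>\<sigma>\<in>UNIV. emp s \<sigma>) = real (\<Sum>\<sigma>\<in>UNIV. count_list s \<sigma>) / real n"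
    using assms by (simp add: emp_def sum_divide_distrib)
  also have "(\<Sum>\<sigma>\<in>UNIV. count_list s \<sigma>) = n"
    using sum_count_set[of s UNIV] assms by simp
  finally show ?thesis
    using assms n_pos count_le_length[of s] by (auto simp: Mn_def emp_def)
qed

text \<open>The numerators sum to \<open>n\<close>, so repeating each state that many times gives a
  configuration. This provides a witness for the choice in \<open>Tm\<close> and lets facts about
  configurations be carried over to \<open>Mn n\<close>.\<close>

lemma Mn_emp:
  assumes "m \<in> Mn n"
  obtains s :: "'s list" where "length s = n" "emp s = m"
proof -
  obtain j where j: "\<And>\<sigma>. m \<sigma> = real (j \<sigma>) / real n"
    using assms unfolding Mn_def mem_Collect_eq by metis
  have "(\<Sum>\<sigma>\<in>UNIV. real (j \<sigma>) / real n) = 1"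
    using assms by (simp add: Mn_def j)
  hence sumj: "(\<Sum>\<sigma>\<in>UNIV. j \<sigma>) = n"
    using n_pos by (simp add: field_simps flip: sum_divide_distrib of_nat_sum)
  obtain s where s: "mset s = (\<Sum>\<sigma>\<in>UNIV. replicate_mset (j \<sigma>) \<sigma>)"
    using ex_mset by blast
  have "length s = n"
    using sumj by (simp flip: size_mset add: s size_multiset_sum)
  moreover have "count_list s \<sigma> = j \<sigma>" for \<sigma>
    by (simp flip: count_mset add: s count_sum)
  ultimately show ?thesis
    using that[of s] by (simp add: emp_def fun_eq_iff j)
qed

text \<open>The place where exchangeability enters. Configurations with equal empirical distribution
  differ by a permutation of the nodes; permuting the noise in the same way preserves its law and
  merely permutes the next configuration. Hence the choice made in \<open>Tm\<close> is
  immaterial.\<close>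

lemma Tm_emp:
  assumes s: "length s = n"
  shows "Tm n f W m' (emp s) = pmf (map_pmf (\<lambda>ws. emp (step s ws)) W) m'"
proof -
  define s0 :: "'s list" where "s0 = (SOME s'. length s' = n \<and> emp s' = emp s)"
  have s0: "length s0 = n \<and> emp s0 = emp s"
    unfolding s0_def by (rule someI[where x = s]) (use s in simp)
  have "mset s0 = mset s" using emp_eq_imp_mset_eq s s0 by metis
  then obtain \<pi> where \<pi>: "\<pi> permutes {..<n}" "permute_list \<pi> s = s0"
    using mset_eq_permutation s by blast
  let ?g = "\<lambda>si wi. f si (emp s) wi"
  have "W = map_pmf (\<lambda>ws. map (\<lambda>i. ws ! \<pi> i) [0..<n]) W"
    using exch \<pi>(1) by (simp add: exchangeable_def)
  \<comment> \<open>The two forms of permuting agree on lists of length \<open>n\<close>, hence on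
    the support of \<open>W\<close>.\<close>
  also have "\<dots> = map_pmf (permute_list \<pi>) W"
    by (rule map_pmf_cong) (auto simp: permute_list_def length_noise)
  finally have W: "map_pmf (permute_list \<pi>) W = W" by simp
  have "Tm n f W m' (emp s) = pmf (map_pmf (\<lambda>ws. emp (map2 ?g s0 ws)) W) m'"
    by (simp add: Tm_def pmf_map vimage_def s0_def)
  also have "map_pmf (\<lambda>ws. emp (map2 ?g s0 ws)) W = map_pmf (\<lambda>ws. emp (map2 ?g s0 (permute_list \<pi> ws))) W"
    by (subst W[symmetric]) (simp add: pmf.map_comp o_def)
  also have "\<dots> = map_pmf (\<lambda>ws. emp (step s ws)) W"
  proof (rule map_pmf_cong[OF refl])
    fix ws assume "ws \<in> set_pmf W"
    hence ws: "length ws = n" by (rule length_noise)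
    have "map2 ?g s0 (permute_list \<pi> ws) = permute_list \<pi> (step s ws)"
      using ws s \<pi>(1) unfolding \<pi>(2)[symmetric]
      by (subst permute_list_map) (auto simp: permute_list_zip[where A = "{..<n}"])
    thus "emp (map2 ?g s0 (permute_list \<pi> ws)) = emp (step s ws)"
      using ws s \<pi>(1) by (simp add: emp_mset_cong[OF mset_permute_list])
  qed
  finally show ?thesis .
qed

lemma Tm_nonneg: "0 \<le> Tm n f W m' m"
  by (simp add: Tm_def Let_def)

lemma set_pmf_step:
  assumes "length s = n"
  shows "set_pmf (map_pmf (\<lambda>ws. emp (step s ws)) W) \<subseteq> Mn n"
  using emp_in_Mn[OF length_step[OF assms]] by auto

lemma Tm_sum:
  assumes "m \<in> Mn n"
  shows "(\<Sum>m'\<in>Mn n. Tm n f W m' m) = 1"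
proof -
  obtain s where s: "length s = n" "emp s = m" using Mn_emp[OF assms] .
  show ?thesis
    unfolding s(2)[symmetric] Tm_emp[OF s(1)]
    by (rule sum_pmf_eq_1[OF finite_Mn set_pmf_step[OF s(1)]])
qed

lemma Tm_outside:
  assumes "m \<in> Mn n" "m' \<notin> Mn n"
  shows "Tm n f W m' m = 0"
proof -
  obtain s where s: "length s = n" "emp s = m" using Mn_emp[OF assms(1)] .
  show ?thesis
    unfolding s(2)[symmetric] Tm_emp[OF s(1)] pmf_eq_0_set_pmf using set_pmf_step[OF s(1)] assms(2) by blast
qed

lemma Tpow_nonneg: "0 \<le> Tpow n f W y m x"
  by (induction y arbitrary: m) (auto intro!: sum_nonneg mult_nonneg_nonneg Tm_nonneg)

lemma Tpow_sum:
  assumes "x \<in> Mn n"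
  shows "(\<Sum>m\<in>Mn n. Tpow n f W y m x) = 1"
proof (induction y)
  case 0
  show ?case using assms finite_Mn by simp
next
  case (Suc y)
  have "(\<Sum>m\<in>Mn n. Tpow n f W (Suc y) m x) = (\<Sum>m''\<in>Mn n. (\<Sum>m\<in>Mn n. Tm n f W m m'') * Tpow n f W y m'' x)"
    by (simp add: sum_distrib_right) (rule sum.swap)
  thus ?case using Suc by (simp add: Tm_sum)
qed

lemma Tpow_outside:
  assumes "x \<in> Mn n" "m \<notin> Mn n"
  shows "Tpow n f W y m x = 0"
  using assms by (cases y) (auto intro!: sum.neutral simp: Tm_outside)

end

section \<open>The collection problem as a finite Bellman operator\<close>

lemma sum_Times_Times_bool:
  "(\<Sum>v\<in>A \<times> B \<times> (UNIV :: bool set). (g v :: real)) = (\<Sum>m\<in>A. \<Sum>m'\<in>B. g (m, m', True) + g (m, m', False))"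
proof -
  have "(\<Sum>v\<in>A \<times> B \<times> (UNIV :: bool set). g v) = (\<Sum>m\<in>A. \<Sum>m'\<in>B. \<Sum>b\<in>UNIV. g (m, m', b))"
    by (simp only: sum.cartesian_product) (simp add: case_prod_unfold)
  thus ?thesis by (simp add: UNIV_bool add.commute)
qed

locale sampled_collection = mean_field n f W
  for n :: nat and f :: "'s::finite \<Rightarrow> ('s \<Rightarrow> real) \<Rightarrow> 'w::finite \<Rightarrow> 's" and W :: "'w list pmf" +
  fixes k :: nat and q \<gamma> cmax :: real
    and c :: "('s \<Rightarrow> real) \<Rightarrow> 'e \<Rightarrow> bool \<Rightarrow> real"
    and h :: "(('s \<Rightarrow> real) \<Rightarrow> real) \<Rightarrow> 'e"
    and mstar :: "'s \<Rightarrow> real"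
  assumes q: "0 \<le> q" "q \<le> 1"
    and gamma: "0 < \<gamma>" "\<gamma> < 1"
    and mstar: "mstar \<in> Mn n"
    and cost: "\<And>m e a. 0 \<le> c m e a" "\<And>m e a. c m e a \<le> cmax"
begin

text \<open>Hidden current distribution, its successor, and the success coin: the incurred cost
  depends on the first, the observation on the other two. The coin is drawn for both actions, and
  \<open>next_pair\<close> ignores it when nothing is collected.\<close>

definition outcomes :: "(('s \<Rightarrow> real) \<times> ('s \<Rightarrow> real) \<times> bool) set" where
  "outcomes = Mn n \<times> Mn n \<times> UNIV"

fun sampled_cost :: "('s \<Rightarrow> real) \<times> nat \<times> bool \<Rightarrow> ('s \<Rightarrow> real) \<times> ('s \<Rightarrow> real) \<times> bool \<Rightarrow> real" where
  "sampled_cost (x, y, a) (m, m', b) = c m (h (\<lambda>m0. Tpow n f W y m0 x)) a"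

fun next_pair :: "('s \<Rightarrow> real) \<times> nat \<times> bool \<Rightarrow> ('s \<Rightarrow> real) \<times> ('s \<Rightarrow> real) \<times> bool \<Rightarrow> bool \<Rightarrow> ('s \<Rightarrow> real) \<times> nat \<times> bool" where
  "next_pair (x, y, a) (m, m', b) a' =
     (case ftilde k mstar x y (if a \<and> b then Some m' else None) of (x', y') \<Rightarrow> (x', y', a'))"

lemma ftilde_in:
  assumes "x \<in> Mn n" "y \<le> k" "ob \<in> insert None (Some ` Mn n)"
  shows "fst (ftilde k mstar x y ob) \<in> Mn n" "snd (ftilde k mstar x y ob) \<le> k"
  using assms mstar by (auto simp: ftilde_def)

sublocale finite_bellman "Dom n k" outcomes "sample_law n f W q" sampled_cost next_pair \<gamma> cmax
proof
  show "finite (Dom n k :: (('s \<Rightarrow> real) \<times> nat \<times> bool) set)" "finite outcomes"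
    using finite_Mn by (auto simp: Dom_def outcomes_def)
  fix z :: "('s \<Rightarrow> real) \<times> nat \<times> bool" and v :: "('s \<Rightarrow> real) \<times> ('s \<Rightarrow> real) \<times> bool"
  obtain x y a where z: "z = (x, y, a)" by (cases z)
  obtain m m' b where v: "v = (m, m', b)" by (cases v)
  show "0 \<le> sampled_cost z v" "sampled_cost z v \<le> cmax"
    using cost by (auto simp: z v)
  assume zD: "z \<in> Dom n k"
  hence xy: "x \<in> Mn n" "y \<le> k" by (auto simp: z Dom_def)
  show "0 \<le> sample_law n f W q z v"
    using q by (auto simp: z v sample_law_def intro!: mult_nonneg_nonneg Tpow_nonneg Tm_nonneg)
  have "(\<Sum>v\<in>outcomes. sample_law n f W q z v) = (\<Sum>m\<in>Mn n. \<Sum>m'\<in>Mn n. Tpow n f W y m x * Tm n f W m' m)"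
    unfolding outcomes_def sum_Times_Times_bool
    by (intro sum.cong refl) (simp add: z sample_law_def algebra_simps)
  also have "\<dots> = 1"
    using Tpow_sum[OF xy(1)] by (simp add: Tm_sum flip: sum_distrib_left)
  finally show "(\<Sum>v\<in>outcomes. sample_law n f W q z v) = 1" .
  show "next_pair z v a' \<in> Dom n k" if "v \<in> outcomes" for a'
    using ftilde_in[OF xy, of "if a \<and> b then Some m' else None"] that
    by (auto simp: z v Dom_def outcomes_def split: prod.splits)
qed (use gamma in auto)

text \<open>Marginalising the samples: in the cost the successor sums out and leaves
  \<open>chat\<close>; in the continuation the current distribution sums out and turns
  \<open>Tpow\<close> at \<open>y\<close> followed by \<open>Tm\<close> into \<open>Tpow\<close> at
  \<open>Suc y\<close>.\<close>

lemma bellman_eq: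
  assumes "(x, y, a) \<in> Dom n k"
  shows "bellman Q (x, y, a) = chat n f W c h x y a + \<gamma> *
           (\<Sum>ob\<in>insert None (Some ` Mn n). Pobs n f W q x y a ob *
              (case ftilde k mstar x y ob of (x', y') \<Rightarrow> min (Q (x', y', False)) (Q (x', y', True))))"
proof -
  have x: "x \<in> Mn n" using assms by (simp add: Dom_def)
  define g where "g ob = (case ftilde k mstar x y ob of (x', y') \<Rightarrow> min (Q (x', y', False)) (Q (x', y', True)))" for ob
  define C where "C m = c m (h (\<lambda>m0. Tpow n f W y m0 x)) a" for m
  have tgt: "target Q (x, y, a) (m, m', b) = C m + \<gamma> * g (if a \<and> b then Some m' else None)" for m m' b
    by (simp add: target_def g_def C_def split: prod.splits)
  have "bellman Q (x, y, a) = (\<Sum>m\<in>Mn n. \<Sum>m'\<in>Mn n. Tpow n f W y m x * C m * Tm n f W m' m) +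
      \<gamma> * (\<Sum>m\<in>Mn n. \<Sum>m'\<in>Mn n. Tpow n f W y m x * Tm n f W m' m *
        (q * g (if a then Some m' else None) + (1 - q) * g None))"
    unfolding bellman_def unfolding outcomes_def sum_Times_Times_bool tgt sum_distrib_left sum.distrib[symmetric]
    by (intro sum.cong refl) (simp add: sample_law_def algebra_simps)
  also have "(\<Sum>m\<in>Mn n. \<Sum>m'\<in>Mn n. Tpow n f W y m x * C m * Tm n f W m' m) = chat n f W c h x y a"
    unfolding sum_distrib_left[symmetric] chat_def C_def by (intro sum.cong refl) (simp add: Tm_sum)
  also have "(\<Sum>m\<in>Mn n. \<Sum>m'\<in>Mn n. Tpow n f W y m x * Tm n f W m' m *
        (q * g (if a then Some m' else None) + (1 - q) * g None)) =
      (\<Sum>ob\<in>insert None (Some ` Mn n). Pobs n f W q x y a ob * g ob)"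
  proof -
    have "(\<Sum>m\<in>Mn n. \<Sum>m'\<in>Mn n. Tpow n f W y m x * Tm n f W m' m *
        (q * g (if a then Some m' else None) + (1 - q) * g None)) =
      (\<Sum>m'\<in>Mn n. Tpow n f W (Suc y) m' x * (q * g (if a then Some m' else None) + (1 - q) * g None))"
      by (subst sum.swap) (simp add: sum_distrib_left sum_distrib_right mult.commute)
    also have "\<dots> = q * (\<Sum>m'\<in>Mn n. Tpow n f W (Suc y) m' x * g (if a then Some m' else None)) +
        (1 - q) * g None * (\<Sum>m'\<in>Mn n. Tpow n f W (Suc y) m' x)"
      unfolding sum_distrib_left sum.distrib[symmetric] by (intro sum.cong refl) (simp only: algebra_simps)
    also have "\<dots> = (\<Sum>ob\<in>insert None (Some ` Mn n). Pobs n f W q x y a ob * g ob)"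
    \<comment> \<open>Without collection both faces of the coin lead to a blank, and their weights
      recombine to one.\<close>
    proof (cases a)
      case True
      thus ?thesis unfolding Tpow_sum[OF x]
        by (simp del: Tpow.simps add: finite_Mn sum.reindex Pobs_def sum_distrib_left mult.assoc image_iff)
    next
      case False
      thus ?thesis unfolding Tpow_sum[OF x]
        by (simp del: Tpow.simps add: finite_Mn sum.reindex Pobs_def Tpow_sum[OF x] image_iff algebra_simps
            flip: sum_distrib_left sum_distrib_right)
    qed
    finally show ?thesis .
  qed
  finally show ?thesis by (simp add: g_def)
qed

abbreviation Qs :: "('s \<Rightarrow> real) \<times> nat \<times> bool \<Rightarrow> real" where
  "Qs \<equiv> Qstar n k f W q c h \<gamma> mstar"

text \<open>The definite description is meaningful: iteration supplies a candidate, contraction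
  determines it on \<open>Dom n k\<close>, and the normalisation determines it elsewhere.\<close>

lemma Qstar_fixed_point:
  assumes "z \<in> Dom n k"
  shows "Qs z = bellman Qs z" "0 \<le> Qs z" "Qs z \<le> vmax"
proof -
  obtain Q where Q: "\<And>z. z \<notin> Dom n k \<Longrightarrow> Q z = 0" "\<And>z. z \<in> Dom n k \<Longrightarrow> Q z = bellman Q z"
    "\<And>z. z \<in> Dom n k \<Longrightarrow> 0 \<le> Q z" "\<And>z. z \<in> Dom n k \<Longrightarrow> Q z \<le> vmax"
    using bellman_fixed_point_exists by metis
  have "Qs = Q"
    unfolding Qstar_def
  proof (rule the_equality, goal_cases)
    case 1
    show ?case using Q(1) Q(2) bellman_eq[where Q = Q] by simp
  next
    case (2 Q')
    have Q': "Q' z = bellman Q' z" if "z \<in> Dom n k" for z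
      using 2 that by (cases z) (simp add: bellman_eq)
    show ?case
    proof
      fix z show "Q' z = Q z"
      proof (cases "z \<in> Dom n k")
        case True
        show ?thesis by (rule bellman_fixed_point_unique[OF Q' Q(2) True])
      qed (use 2 Q(1) in metis)
    qed
  qed
  with Q assms show "Qs z = bellman Qs z" "0 \<le> Qs z" "Qs z \<le> vmax" by simp_all
qed

definition best :: "('s \<Rightarrow> real) \<times> nat \<Rightarrow> real" where
  "best = (\<lambda>(x, y). min (Qs (x, y, False)) (Qs (x, y, True)))"

lemma Qlearn_Suc:
  "Qlearn n k f W c h \<gamma> mstar \<alpha> \<xi> (Suc \<tau>) z \<omega> =
     (1 - \<alpha> \<tau> z \<omega>) * Qlearn n k f W c h \<gamma> mstar \<alpha> \<xi> \<tau> z \<omega>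
     + \<alpha> \<tau> z \<omega> * target (\<lambda>z'. Qlearn n k f W c h \<gamma> mstar \<alpha> \<xi> \<tau> z' \<omega>) z (\<xi> \<tau> z \<omega>)"
  by (cases z; cases "\<xi> \<tau> z \<omega>") (simp add: target_def Let_def split: prod.splits)

end

section \<open>Beliefs and the cost of a strategy\<close>

lemma expectation_pmf_cong:
  assumes "\<And>x. x \<in> set_pmf p \<Longrightarrow> u x = v x"
  shows "measure_pmf.expectation p u = measure_pmf.expectation p v"
  using assms by (intro integral_cong_AE) (auto simp: AE_measure_pmf_iff)

lemma expectation_pmf_mono_finite:
  fixes u v :: "'a \<Rightarrow> real"
  assumes "finite (set_pmf p)" "\<And>x. x \<in> set_pmf p \<Longrightarrow> u x \<le> v x"
  shows "measure_pmf.expectation p u \<le> measure_pmf.expectation p v"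
  using assms by (intro integral_mono_AE) (auto simp: AE_measure_pmf_iff intro: integrable_measure_pmf_finite)

lemma expectation_bind_pmf_finite:
  fixes u :: "'b \<Rightarrow> real"
  assumes "finite (set_pmf p)" "\<And>x. x \<in> set_pmf p \<Longrightarrow> finite (set_pmf (K x))"
  shows "measure_pmf.expectation (p \<bind> K) u = measure_pmf.expectation p (\<lambda>x. measure_pmf.expectation (K x) u)"
  using assms by (subst pmf_expectation_bind[of "set_pmf p"]) (auto simp: integral_measure_pmf[of "set_pmf p"])

lemma track_snoc:
  "os \<noteq> [] \<Longrightarrow> track k mstar (os @ [ob]) = ftilde k mstar (fst (track k mstar os)) (snd (track k mstar os)) ob"
  by (simp add: track_def split: prod.splits)

text \<open>One fixed but arbitrary strategy; the comparison at the end interprets this twice, for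
  the greedy strategy and for a competitor.\<close>

locale collection_run = sampled_collection n f W k q \<gamma> cmax c h mstar
  for n :: nat and f :: "'s::finite \<Rightarrow> ('s \<Rightarrow> real) \<Rightarrow> 'w::finite \<Rightarrow> 's" and W :: "'w list pmf"
    and k :: nat and q \<gamma> cmax :: real and c :: "('s \<Rightarrow> real) \<Rightarrow> 'e \<Rightarrow> bool \<Rightarrow> real"
    and h :: "(('s \<Rightarrow> real) \<Rightarrow> real) \<Rightarrow> 'e" and mstar :: "'s \<Rightarrow> real" +
  fixes S1 :: "'s list pmf" and g :: "nat \<Rightarrow> ('s \<Rightarrow> real) option list \<Rightarrow> bool list \<Rightarrow> bool"
  assumes init: "\<And>s. s \<in> set_pmf S1 \<Longrightarrow> length s = n"
begin

abbreviation D :: "nat \<Rightarrow> ('s list \<times> ('s \<Rightarrow> real) option list \<times> bool list) pmf" where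
  "D t \<equiv> Dproc f W q S1 g t"

abbreviation lastobs :: "('s \<Rightarrow> real) option list \<Rightarrow> 's \<Rightarrow> real" where
  "lastobs os \<equiv> fst (track k mstar os)"

abbreviation age :: "('s \<Rightarrow> real) option list \<Rightarrow> nat" where
  "age os \<equiv> snd (track k mstar os)"

text \<open>The configuration enters only through its empirical distribution. By
  \<open>Tm_emp\<close> one time step preserves this class of functionals, so configurations need no
  further tracking.\<close>

definition mean :: "nat \<Rightarrow> (('s \<Rightarrow> real) \<Rightarrow> ('s \<Rightarrow> real) option list \<Rightarrow> bool list \<Rightarrow> real) \<Rightarrow> real" where
  "mean t \<psi> = measure_pmf.expectation (D t) (\<lambda>(s, os, as). \<psi> (emp s) os as)"

definition prob_success :: "bool \<Rightarrow> real" where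
  "prob_success a = (if a then q else 0)"

lemma finite_set_W: "finite (set_pmf W)"
  by (rule finite_subset[OF _ finite_lists_length_eq[of UNIV n]]) (auto simp: length_noise)

lemma finite_set_S1: "finite (set_pmf S1)"
  by (rule finite_subset[OF _ finite_lists_length_eq[of UNIV n]]) (auto simp: init)

lemma finite_set_D: "finite (set_pmf (D t))"
proof (induction t)
  case (Suc t)
  have "finite (set_pmf (bernoulli_pmf q))" by (rule finite_subset[of _ UNIV]) auto
  with Suc finite_set_W show ?case by (auto simp: Let_def)
qed (use finite_set_S1 in simp)

text \<open>The decisive bound is \<open>age os \<le> t\<close>: a transition that starts before
  time \<open>k\<close> starts at an age below \<open>k\<close> and therefore cannot trigger the
  reset.\<close>

lemma set_D:
  assumes "(s, os, as) \<in> set_pmf (D t)"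
  shows "length s = n \<and> os \<noteq> [] \<and> lastobs os \<in> Mn n \<and> age os \<le> k \<and> age os \<le> t"
  using assms
proof (induction t arbitrary: s os as)
  case 0
  thus ?case using init emp_in_Mn by (auto simp: track_def)
next
  case (Suc t)
  then obtain s0 os0 as0 ws b where 0: "(s0, os0, as0) \<in> set_pmf (D t)" "ws \<in> set_pmf W" "s = step s0 ws"
    "os = os0 @ [if b then Some (emp s) else None]"
    by (auto simp: Let_def)
  note IH = Suc.IH[OF 0(1)]
  have s: "length s = n" using 0 IH length_step by blast
  have "track k mstar os = ftilde k mstar (lastobs os0) (age os0) (if b then Some (emp s) else None)"
    using IH by (simp add: 0(4) track_snoc)
  with IH s mstar emp_in_Mn[OF s] show ?case by (auto simp: 0(4) ftilde_def)
qed

lemma mean_cong: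
  assumes "\<And>s os as. (s, os, as) \<in> set_pmf (D t) \<Longrightarrow> \<psi> (emp s) os as = \<phi> (emp s) os as"
  shows "mean t \<psi> = mean t \<phi>"
  unfolding mean_def by (rule expectation_pmf_cong) (use assms in auto)

lemma mean_mono:
  assumes "\<And>s os as. (s, os, as) \<in> set_pmf (D t) \<Longrightarrow> \<psi> (emp s) os as \<le> \<phi> (emp s) os as"
  shows "mean t \<psi> \<le> mean t \<phi>"
  unfolding mean_def by (rule expectation_pmf_mono_finite[OF finite_set_D]) (use assms in auto)

lemma mean_const: "mean t (\<lambda>_ _ _. r) = r"
  by (simp add: mean_def split_def measure_pmf.prob_space)

lemma mean_affine:
  "mean t (\<lambda>m os as. \<psi> m os as + r * \<phi> m os as) = mean t \<psi> + r * mean t \<phi>"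
  unfolding mean_def split_def by (simp add: integrable_measure_pmf_finite[OF finite_set_D])

text \<open>The noise and the coin are integrated out given the present history;
  \<open>prob_success\<close> covers both actions, being 0 when nothing is collected.\<close>

lemma mean_Suc:
  "mean (Suc t) \<psi> = mean t (\<lambda>m os as. \<Sum>m'\<in>Mn n. Tm n f W m' m *
     ((1 - prob_success (g t os as)) * \<psi> m' (os @ [None]) (as @ [g t os as]) +
      prob_success (g t os as) * \<psi> m' (os @ [Some m']) (as @ [g t os as])))"
proof -
  define \<rho> where "\<rho> os as m' = (1 - prob_success (g t os as)) * \<psi> m' (os @ [None]) (as @ [g t os as]) +
      prob_success (g t os as) * \<psi> m' (os @ [Some m']) (as @ [g t os as])" for os as m'
  define K where "K s os as = W \<bind> (\<lambda>ws. (if g t os as then bernoulli_pmf q else return_pmf False) \<bind> (\<lambda>b.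
      return_pmf (step s ws, os @ [if b then Some (emp (step s ws)) else None], as @ [g t os as])))" for s os as
  have fb: "finite (set_pmf (if a then bernoulli_pmf q else return_pmf False))" for a
    by (rule finite_subset[of _ UNIV]) auto
  have finK: "finite (set_pmf (K s os as))" for s os as
    using finite_set_W fb by (auto simp: K_def)
  have DS: "D (Suc t) = D t \<bind> (\<lambda>(s, os, as). K s os as)"
    by (simp add: K_def Let_def)
  have K: "measure_pmf.expectation (K s os as) (\<lambda>(s, os, as). \<psi> (emp s) os as) =
      (\<Sum>m'\<in>Mn n. Tm n f W m' (emp s) * \<rho> os as m')" if s: "length s = n" for s os as
  proof -
    have "measure_pmf.expectation (K s os as) (\<lambda>(s, os, as). \<psi> (emp s) os as) =
        measure_pmf.expectation W (\<lambda>ws. \<rho> os as (emp (step s ws)))"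
      unfolding K_def using finite_set_W fb q
      by (subst expectation_bind_pmf_finite)
        (auto simp: expectation_bind_pmf_finite \<rho>_def prob_success_def add.commute
          intro!: Bochner_Integration.integral_cong)
    also have "\<dots> = measure_pmf.expectation (map_pmf (\<lambda>ws. emp (step s ws)) W) (\<rho> os as)"
      by simp
    also have "\<dots> = (\<Sum>m'\<in>Mn n. Tm n f W m' (emp s) * \<rho> os as m')"
      using set_pmf_step[OF s] by (subst integral_measure_pmf[OF finite_Mn]) (auto simp: Tm_emp[OF s])
    finally show ?thesis .
  qed
  show ?thesis
    unfolding mean_def DS
    by (subst expectation_bind_pmf_finite[OF finite_set_D])
      (use finK set_D K in \<open>auto intro!: expectation_pmf_cong simp: \<rho>_def\<close>)
qed

lemma sum_Tpow_Suc:
  "(\<Sum>m\<in>Mn n. Tpow n f W y m x * (\<Sum>m'\<in>Mn n. Tm n f W m' m * u m')) = (\<Sum>m'\<in>Mn n. Tpow n f W (Suc y) m' x * u m')"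
proof -
  have "(\<Sum>m\<in>Mn n. Tpow n f W y m x * (\<Sum>m'\<in>Mn n. Tm n f W m' m * u m')) =
      (\<Sum>m\<in>Mn n. \<Sum>m'\<in>Mn n. Tm n f W m' m * Tpow n f W y m x * u m')"
    by (simp add: sum_distrib_left algebra_simps)
  also have "\<dots> = (\<Sum>m'\<in>Mn n. \<Sum>m\<in>Mn n. Tm n f W m' m * Tpow n f W y m x * u m')"
    by (rule sum.swap)
  finally show ?thesis by (simp add: sum_distrib_right)
qed

text \<open>Averaging over the hidden empirical distribution given the observed history amounts to
  averaging over \<open>T\<^sup>y(\<cdot>, x)\<close>, as long as the truncation at age \<open>k\<close> has not become active.\<close>

lemma mean_hidden:
  "t \<le> k \<Longrightarrow> mean t \<psi> = mean t (\<lambda>_ os as. \<Sum>m\<in>Mn n. Tpow n f W (age os) m (lastobs os) * \<psi> m os as)"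
  and mean_Suc_hidden:
  "t \<le> k \<Longrightarrow> mean (Suc t) \<psi> = mean t (\<lambda>_ os as.
     (1 - prob_success (g t os as)) *
        (\<Sum>m'\<in>Mn n. Tpow n f W (Suc (age os)) m' (lastobs os) * \<psi> m' (os @ [None]) (as @ [g t os as])) +
     prob_success (g t os as) *
        (\<Sum>m'\<in>Mn n. Tpow n f W (Suc (age os)) m' (lastobs os) * \<psi> m' (os @ [Some m']) (as @ [g t os as])))"
proof -
  \<comment> \<open>With the hidden-state formula as a premise, this serves both the induction and
    the second claim. It does not mention the pair tracked after the transition, so it remains valid
    from \<open>t = k\<close> to \<open>k + 1\<close>; this gives the last of the
    \<open>k + 1\<close> Bellman steps.\<close>
  have step: "mean (Suc t) \<psi> = mean t (\<lambda>_ os as.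
     (1 - prob_success (g t os as)) *
        (\<Sum>m'\<in>Mn n. Tpow n f W (Suc (age os)) m' (lastobs os) * \<psi> m' (os @ [None]) (as @ [g t os as])) +
     prob_success (g t os as) *
        (\<Sum>m'\<in>Mn n. Tpow n f W (Suc (age os)) m' (lastobs os) * \<psi> m' (os @ [Some m']) (as @ [g t os as])))"
    if hid: "\<And>\<psi>. mean t \<psi> = mean t (\<lambda>_ os as. \<Sum>m\<in>Mn n. Tpow n f W (age os) m (lastobs os) * \<psi> m os as)" for t \<psi>
    unfolding mean_Suc
    by (subst hid, rule mean_cong, unfold sum_Tpow_Suc, unfold sum_distrib_left sum.distrib[symmetric])
      (intro sum.cong refl, simp only: algebra_simps)
  have hid: "mean t \<psi> = mean t (\<lambda>_ os as. \<Sum>m\<in>Mn n. Tpow n f W (age os) m (lastobs os) * \<psi> m os as)" if "t \<le> k" for t \<psi>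
    using that
  proof (induction t arbitrary: \<psi>)
    case 0
    show ?case
    proof (rule mean_cong)
      fix s os as assume a: "(s, os, as) \<in> set_pmf (D 0)"
      hence "track k mstar os = (emp s, 0)" "emp s \<in> Mn n" using init emp_in_Mn by (auto simp: track_def)
      thus "\<psi> (emp s) os as = (\<Sum>m\<in>Mn n. Tpow n f W (age os) m (lastobs os) * \<psi> m os as)"
        using finite_Mn by (simp add: if_distrib[of "\<lambda>x. x * _"] cong: if_cong)
    qed
  next
    case (Suc t)
    have IH: "\<And>\<psi>. mean t \<psi> = mean t (\<lambda>_ os as. \<Sum>m\<in>Mn n. Tpow n f W (age os) m (lastobs os) * \<psi> m os as)"
      using Suc by simp
    show ?case
      unfolding step[OF IH]
    proof (rule mean_cong)
      fix s os as assume "(s, os, as) \<in> set_pmf (D t)"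
      \<comment> \<open>Strict inequality excludes the reset. After a blank the inner average does
        not depend on \<open>m'\<close>, and the outer weights sum to one; after an observation the
        age is 0 and the inner average is evaluation at \<open>m'\<close>.\<close>
      from set_D[OF this] Suc.prems have os: "os \<noteq> []" "lastobs os \<in> Mn n" "age os < k" by auto
      let ?a = "g t os as"
      have None: "track k mstar (os @ [None]) = (lastobs os, Suc (age os))"
        using os by (simp add: track_snoc ftilde_def)
      have Some: "track k mstar (os @ [Some m']) = (m', 0)" for m'
        using os by (simp add: track_snoc ftilde_def)
      have *: "(\<Sum>m\<in>Mn n. Tpow n f W 0 m m' * u m) = u m'" if "m' \<in> Mn n" for m' and u :: "_ \<Rightarrow> real"
        using that finite_Mn by (simp add: if_distrib[of "\<lambda>x. x * _"] cong: if_cong)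
      show "(1 - prob_success ?a) *
          (\<Sum>m'\<in>Mn n. Tpow n f W (Suc (age os)) m' (lastobs os) * \<psi> m' (os @ [None]) (as @ [?a])) +
        prob_success ?a *
          (\<Sum>m'\<in>Mn n. Tpow n f W (Suc (age os)) m' (lastobs os) * \<psi> m' (os @ [Some m']) (as @ [?a])) =
        (1 - prob_success ?a) *
          (\<Sum>m'\<in>Mn n. Tpow n f W (Suc (age os)) m' (lastobs os) * (\<Sum>m\<in>Mn n.
            Tpow n f W (age (os @ [None])) m (lastobs (os @ [None])) * \<psi> m (os @ [None]) (as @ [?a]))) +
        prob_success ?a *
          (\<Sum>m'\<in>Mn n. Tpow n f W (Suc (age os)) m' (lastobs os) * (\<Sum>m\<in>Mn n.
            Tpow n f W (age (os @ [Some m'])) m (lastobs (os @ [Some m'])) * \<psi> m (os @ [Some m']) (as @ [?a])))"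
        unfolding None Some fst_conv snd_conv sum_distrib_right[symmetric] Tpow_sum[OF os(2)]
        by (simp del: Tpow.simps add: * cong: sum.cong)
    qed
  qed
  show "t \<le> k \<Longrightarrow> mean t \<psi> = mean t (\<lambda>_ os as. \<Sum>m\<in>Mn n. Tpow n f W (age os) m (lastobs os) * \<psi> m os as)"
    by (rule hid)
  show "t \<le> k \<Longrightarrow> mean (Suc t) \<psi> = mean t (\<lambda>_ os as.
     (1 - prob_success (g t os as)) *
        (\<Sum>m'\<in>Mn n. Tpow n f W (Suc (age os)) m' (lastobs os) * \<psi> m' (os @ [None]) (as @ [g t os as])) +
     prob_success (g t os as) *
        (\<Sum>m'\<in>Mn n. Tpow n f W (Suc (age os)) m' (lastobs os) * \<psi> m' (os @ [Some m']) (as @ [g t os as])))"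
    by (rule step[OF hid])
qed

text \<open>\<open>mean_hidden\<close> for the indicator of a history and a value \<open>m\<close>
  factors the joint probability; the history has positive probability and cancels. Equality is
  needed also for \<open>m\<close> outside \<open>Mn n\<close>, since \<open>h\<close> receives the
  whole function.\<close>

lemma belief_eq_Tpow:
  assumes "t \<le> k" "(s, os, as) \<in> set_pmf (D t)"
  shows "belief (D t) os as = (\<lambda>m. Tpow n f W (age os) m (lastobs os))"
proof
  fix m
  have prob_eq: "measure_pmf.prob (D t) A = measure_pmf.expectation (D t) (indicator A)" for A
    by simp
  let ?P = "measure_pmf.prob (D t) {(s', os', as'). os' = os \<and> as' = as}"
  have P: "?P = mean t (\<lambda>_ os' as'. if os' = os \<and> as' = as then 1 else 0)"
    unfolding mean_def prob_eq
    by (rule Bochner_Integration.integral_cong) (auto simp: indicator_def split: if_splits)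
  have "measure_pmf.prob (D t) {(s', os', as'). os' = os \<and> as' = as \<and> emp s' = m}
      = mean t (\<lambda>m' os' as'. if os' = os \<and> as' = as \<and> m' = m then 1 else 0)"
    unfolding mean_def prob_eq
    by (rule Bochner_Integration.integral_cong) (auto simp: indicator_def split: if_splits)
  \<comment> \<open>The summand 0 gives the integrand the shape required by
    \<open>mean_affine\<close>.\<close>
  also have "\<dots> = mean t (\<lambda>_ os' as'. 0 + Tpow n f W (age os) m (lastobs os) * (if os' = os \<and> as' = as then 1 else 0))"
  proof (subst mean_hidden[OF assms(1)], rule mean_cong)
    fix s' os' as'
    show "(\<Sum>m'\<in>Mn n. Tpow n f W (age os') m' (lastobs os') * (if os' = os \<and> as' = as \<and> m' = m then 1 else 0)) =
        0 + Tpow n f W (age os) m (lastobs os) * (if os' = os \<and> as' = as then 1 else 0)"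
      using set_D[OF assms(2)] finite_Mn
      by (cases "m \<in> Mn n") (auto simp: Tpow_outside if_distrib[of "\<lambda>x. _ * x"] cong: if_cong)
  qed
  also have "\<dots> = Tpow n f W (age os) m (lastobs os) * ?P"
    unfolding mean_affine P mean_const by simp
  finally have "measure_pmf.prob (D t) {(s', os', as'). os' = os \<and> as' = as \<and> emp s' = m} =
      Tpow n f W (age os) m (lastobs os) * ?P" .
  moreover have "?P \<noteq> 0"
    using assms(2) by (auto simp: measure_pmf_zero_iff)
  ultimately show "belief (D t) os as m = Tpow n f W (age os) m (lastobs os)"
    by (simp add: belief_def)
qed

section \<open>Comparing the cost of a strategy with the value function\<close>

definition stage_cost :: "nat \<Rightarrow> real" where
  "stage_cost t = measure_pmf.expectation (D t)
      (\<lambda>(s, os, as). c (emp s) (h (belief (D t) os as)) (g t os as))"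

lemma stage_cost_bounds: "0 \<le> stage_cost t" "stage_cost t \<le> cmax"
proof -
  have eq: "stage_cost t = mean t (\<lambda>m os as. c m (h (belief (D t) os as)) (g t os as))"
    by (simp add: stage_cost_def mean_def)
  show "0 \<le> stage_cost t" "stage_cost t \<le> cmax"
    unfolding eq using mean_mono[of t "\<lambda>_ _ _. 0"] mean_mono[of t _ "\<lambda>_ _ _. cmax"] cost
    by (simp_all add: mean_const)
qed

text \<open>The Bellman equation averaged over histories: the known belief turns the stage cost into
  \<open>chat\<close>, and the next observation has law \<open>Pobs\<close>. At \<open>t = k\<close>
  a reset may occur, but \<open>track\<close> and the equation for \<open>Qstar\<close> perform the
  same one.\<close>

lemma stage_cost_add_best:
  assumes "t \<le> k"
  shows "stage_cost t + \<gamma> * mean (Suc t) (\<lambda>_ os _. best (track k mstar os)) =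
    mean t (\<lambda>_ os as. Qs (lastobs os, age os, g t os as))"
proof -
  have "stage_cost t = mean t (\<lambda>m os as. c m (h (\<lambda>m0. Tpow n f W (age os) m0 (lastobs os))) (g t os as))"
    unfolding stage_cost_def mean_def by (rule expectation_pmf_cong) (use belief_eq_Tpow[OF assms] in auto)
  also have "\<dots> = mean t (\<lambda>_ os as. chat n f W c h (lastobs os) (age os) (g t os as))"
    by (subst mean_hidden[OF assms]) (simp add: chat_def mult.commute)
  finally have 1: "stage_cost t = mean t (\<lambda>_ os as. chat n f W c h (lastobs os) (age os) (g t os as))" .
  have 2: "mean (Suc t) (\<lambda>_ os _. best (track k mstar os)) = mean t (\<lambda>_ os as.
      \<Sum>ob\<in>insert None (Some ` Mn n). Pobs n f W q (lastobs os) (age os) (g t os as) ob *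
        best (ftilde k mstar (lastobs os) (age os) ob))"
    unfolding mean_Suc_hidden[OF assms]
  proof (rule mean_cong)
    fix s os as assume "(s, os, as) \<in> set_pmf (D t)"
    from set_D[OF this] have os: "os \<noteq> []" "lastobs os \<in> Mn n" by auto
    show "(1 - prob_success (g t os as)) *
        (\<Sum>m'\<in>Mn n. Tpow n f W (Suc (age os)) m' (lastobs os) * best (track k mstar (os @ [None]))) +
      prob_success (g t os as) *
        (\<Sum>m'\<in>Mn n. Tpow n f W (Suc (age os)) m' (lastobs os) * best (track k mstar (os @ [Some m']))) =
      (\<Sum>ob\<in>insert None (Some ` Mn n). Pobs n f W q (lastobs os) (age os) (g t os as) ob *
        best (ftilde k mstar (lastobs os) (age os) ob))"
      unfolding track_snoc[OF os(1)] sum_distrib_right[symmetric] Tpow_sum[OF os(2)]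
      by (simp del: Tpow.simps add: finite_Mn sum.reindex Pobs_def prob_success_def image_iff sum_distrib_left mult.assoc)
  qed
  show ?thesis
    unfolding 1 2 mean_affine[symmetric]
  proof (rule mean_cong)
    fix s os as assume "(s, os, as) \<in> set_pmf (D t)"
    from set_D[OF this] have D: "(lastobs os, age os, g t os as) \<in> Dom n k" by (simp add: Dom_def)
    show "chat n f W c h (lastobs os) (age os) (g t os as) + \<gamma> *
        (\<Sum>ob\<in>insert None (Some ` Mn n). Pobs n f W q (lastobs os) (age os) (g t os as) ob *
        best (ftilde k mstar (lastobs os) (age os) ob)) = Qs (lastobs os, age os, g t os as)"
      unfolding Qstar_fixed_point(1)[OF D] bellman_eq[OF D] by (simp add: best_def)
  qed
qed

lemma mean_best_bounds:
  "0 \<le> mean t (\<lambda>_ os _. best (track k mstar os))" "mean t (\<lambda>_ os _. best (track k mstar os)) \<le> vmax"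
proof -
  have "0 \<le> best (track k mstar os) \<and> best (track k mstar os) \<le> vmax" if "(s, os, as) \<in> set_pmf (D t)" for s os as
    using set_D[OF that] Qstar_fixed_point(2,3)[of "(lastobs os, age os, _)"]
    by (auto simp: best_def split_def Dom_def min_def)
  thus "0 \<le> mean t (\<lambda>_ os _. best (track k mstar os))" "mean t (\<lambda>_ os _. best (track k mstar os)) \<le> vmax"
    using mean_mono[of t "\<lambda>_ _ _. 0" "\<lambda>_ os _. best (track k mstar os)"]
      mean_mono[of t "\<lambda>_ os _. best (track k mstar os)" "\<lambda>_ _ _. vmax"]
    by (simp_all add: mean_const)
qed

lemma best_le_Q: "best (track k mstar os) \<le> Qs (lastobs os, age os, a)"
  by (cases a) (auto simp: best_def split_def)

text \<open>Any action has Q-value at least \<open>best\<close>, so the averaged Bellman equations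
  telescope to an inequality. It stops at \<open>Suc k\<close> because later beliefs may disagree
  with the tracked pair.\<close>

lemma cost_to_k_lower:
  assumes "N \<le> Suc k"
  shows "mean 0 (\<lambda>_ os _. best (track k mstar os)) \<le>
    (\<Sum>t<N. \<gamma> ^ t * stage_cost t) + \<gamma> ^ N * mean N (\<lambda>_ os _. best (track k mstar os))"
  using assms
proof (induction N)
  case (Suc N)
  have "mean N (\<lambda>_ os _. best (track k mstar os)) \<le>
      stage_cost N + \<gamma> * mean (Suc N) (\<lambda>_ os _. best (track k mstar os))"
    using Suc.prems by (subst stage_cost_add_best) (auto intro!: mean_mono best_le_Q)
  hence "\<gamma> ^ N * mean N (\<lambda>_ os _. best (track k mstar os)) \<le>
      \<gamma> ^ N * (stage_cost N + \<gamma> * mean (Suc N) (\<lambda>_ os _. best (track k mstar os)))"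
    using gamma by (intro mult_left_mono) auto
  with Suc show ?case by (simp add: algebra_simps)
qed simp

lemma cost_to_k_greedy:
  assumes "N \<le> Suc k"
    and greedy: "\<And>t s os as. (s, os, as) \<in> set_pmf (D t) \<Longrightarrow>
      Qs (lastobs os, age os, g t os as) = best (track k mstar os)"
  shows "mean 0 (\<lambda>_ os _. best (track k mstar os)) =
    (\<Sum>t<N. \<gamma> ^ t * stage_cost t) + \<gamma> ^ N * mean N (\<lambda>_ os _. best (track k mstar os))"
  using assms(1)
proof (induction N)
  case (Suc N)
  have "mean N (\<lambda>_ os _. best (track k mstar os)) =
      stage_cost N + \<gamma> * mean (Suc N) (\<lambda>_ os _. best (track k mstar os))"
    using Suc.prems by (subst stage_cost_add_best) (auto intro!: mean_cong simp: greedy)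
  with Suc show ?case by (simp add: algebra_simps)
qed simp

lemma Jval_eq: "Jval f W q S1 c h \<gamma> g = (\<Sum>t. \<gamma> ^ t * stage_cost t)"
  by (simp add: Jval_def stage_cost_def)

lemma Jval_bounds:
  "(\<Sum>t<N. \<gamma> ^ t * stage_cost t) \<le> Jval f W q S1 c h \<gamma> g"
  "Jval f W q S1 c h \<gamma> g \<le> (\<Sum>t<N. \<gamma> ^ t * stage_cost t) + \<gamma> ^ N * vmax"
proof -
  have geo: "(\<lambda>t. \<gamma> ^ (t + N) * cmax) sums (\<gamma> ^ N * vmax)"
    using sums_mult2[OF geometric_sums[of \<gamma>], of "\<gamma> ^ N * cmax"] gamma
    by (simp add: power_add vmax_def mult_ac)
  have le: "\<gamma> ^ t * stage_cost t \<le> \<gamma> ^ t * cmax" "0 \<le> \<gamma> ^ t * stage_cost t" for t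
    using stage_cost_bounds gamma by (auto intro!: mult_left_mono)
  have "summable (\<lambda>t. \<gamma> ^ t * cmax)"
    using gamma by (intro summable_mult2 summable_geometric) auto
  hence s: "summable (\<lambda>t. \<gamma> ^ t * stage_cost t)"
    by (rule summable_comparison_test'[where N = 0]) (use le in auto)
  show "(\<Sum>t<N. \<gamma> ^ t * stage_cost t) \<le> Jval f W q S1 c h \<gamma> g"
    unfolding Jval_eq by (rule sum_le_suminf[OF s]) (use le in auto)
  have "(\<Sum>t. \<gamma> ^ (t + N) * stage_cost (t + N)) \<le> \<gamma> ^ N * vmax"
    unfolding sums_unique[OF geo]
    by (rule suminf_le) (use le(1) summable_ignore_initial_segment[OF s] sums_summable[OF geo] in auto)
  thus "Jval f W q S1 c h \<gamma> g \<le> (\<Sum>t<N. \<gamma> ^ t * stage_cost t) + \<gamma> ^ N * vmax"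
    unfolding Jval_eq using suminf_split_initial_segment[OF s, of N] by simp
qed

text \<open>Later costs are dropped as nonnegative, and the value remaining at time
  \<open>Suc k\<close> is at most \<open>vmax\<close>.\<close>

lemma Jval_lower:
  "mean 0 (\<lambda>_ os _. best (track k mstar os)) - \<gamma> ^ Suc k * vmax \<le> Jval f W q S1 c h \<gamma> g"
proof -
  have "\<gamma> ^ Suc k * mean (Suc k) (\<lambda>_ os _. best (track k mstar os)) \<le> \<gamma> ^ Suc k * vmax"
    using gamma by (intro mult_left_mono mean_best_bounds) auto
  with cost_to_k_lower[of "Suc k"] Jval_bounds(1)[of "Suc k"] show ?thesis by simp
qed

text \<open>The roles are exchanged: the remaining value is dropped as nonnegative, and the later
  true costs are bounded by the geometric tail.\<close>

lemma Jval_greedy: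
  assumes "\<And>t s os as. (s, os, as) \<in> set_pmf (D t) \<Longrightarrow>
      Qs (lastobs os, age os, g t os as) = best (track k mstar os)"
  shows "Jval f W q S1 c h \<gamma> g \<le> mean 0 (\<lambda>_ os _. best (track k mstar os)) + \<gamma> ^ Suc k * vmax"
proof -
  have "0 \<le> \<gamma> ^ Suc k * mean (Suc k) (\<lambda>_ os _. best (track k mstar os))"
    using mean_best_bounds(1) gamma by simp
  with cost_to_k_greedy[of "Suc k", OF _ assms] Jval_bounds(2)[of "Suc k"] show ?thesis by simp
qed

end

section \<open>The choice of the truncation age and the final comparison\<close>

theorem theorem5:
  fixes n k :: nat
    and f :: "'s::finite \<Rightarrow> ('s \<Rightarrow> real) \<Rightarrow> 'w::finite \<Rightarrow> 's"
    and W :: "'w list pmf" and S1 :: "'s list pmf"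
    and q \<gamma> \<epsilon> cmax :: real
    and c :: "('s \<Rightarrow> real) \<Rightarrow> 'e \<Rightarrow> bool \<Rightarrow> real"
    and h :: "(('s \<Rightarrow> real) \<Rightarrow> real) \<Rightarrow> 'e"
    and mstar :: "'s \<Rightarrow> real"
    and M :: "'om measure" and F :: "nat \<Rightarrow> 'om measure"
    and \<alpha> :: "nat \<Rightarrow> (('s \<Rightarrow> real) \<times> nat \<times> bool) \<Rightarrow> 'om \<Rightarrow> real"
    and \<xi> :: "nat \<Rightarrow> (('s \<Rightarrow> real) \<times> nat \<times> bool) \<Rightarrow> 'om \<Rightarrow> ('s \<Rightarrow> real) \<times> ('s \<Rightarrow> real) \<times> bool"
  assumes n_pos: "n \<ge> 1"
    and q: "0 \<le> q" "q \<le> 1"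
    and gamma: "0 < \<gamma>" "\<gamma> < 1"
    and eps: "\<epsilon> > 0"
    and exch: "exchangeable n W"
    and init: "\<forall>s\<in>set_pmf S1. length s = n"
    and mstar: "mstar \<in> Mn n"
    and cost: "\<forall>m e a. 0 \<le> c m e a \<and> c m e a \<le> cmax"
    and k: "real k \<ge> ln ((1 - \<gamma>) * \<epsilon> / (2 * cmax)) / ln \<gamma>"
    and M: "prob_space M"
    and filt: "\<forall>\<tau>. subalgebra M (F \<tau>)" "\<forall>\<tau>. sets (F \<tau>) \<subseteq> sets (F (Suc \<tau>))"
    and alpha_meas: "\<forall>\<tau> z. z \<in> Dom n k \<longrightarrow> \<alpha> \<tau> z \<in> borel_measurable (F \<tau>)"
    and alpha_range: "\<forall>\<tau> z \<omega>. z \<in> Dom n k \<longrightarrow> \<omega> \<in> space M \<longrightarrow> 0 \<le> \<alpha> \<tau> z \<omega> \<and> \<alpha> \<tau> z \<omega> \<le> 1"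
    and sample_meas: "\<forall>\<tau> z v. z \<in> Dom n k \<longrightarrow> {\<omega> \<in> space M. \<xi> \<tau> z \<omega> = v} \<in> sets (F (Suc \<tau>))"
    and sample_law: "\<forall>\<tau> z v E. z \<in> Dom n k \<longrightarrow> E \<in> sets (F \<tau>) \<longrightarrow>
        measure M (E \<inter> {\<omega> \<in> space M. \<xi> \<tau> z \<omega> = v}) = measure M E * sample_law n f W q z v"
    and alpha_sum: "\<forall>z\<in>Dom n k. AE \<omega> in M. filterlim (\<lambda>N. \<Sum>\<tau><N. \<alpha> \<tau> z \<omega>) at_top sequentially"
    and alpha_sq: "\<forall>z\<in>Dom n k. AE \<omega> in M. summable (\<lambda>\<tau>. (\<alpha> \<tau> z \<omega>)\<^sup>2)"
    and inf_often: "\<forall>z\<in>Dom n k. AE \<omega> in M. (\<exists>\<^sub>\<infinity>\<tau>. \<alpha> \<tau> z \<omega> > 0)"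
  shows "(\<forall>z\<in>Dom n k. AE \<omega> in M.
            (\<lambda>\<tau>. Qlearn n k f W c h \<gamma> mstar \<alpha> \<xi> \<tau> z \<omega>) \<longlonglongrightarrow> Qstar n k f W q c h \<gamma> mstar z)
       \<and> (\<forall>G :: ('s \<Rightarrow> real) \<times> nat \<Rightarrow> bool.
            (\<forall>x y. x \<in> Mn n \<longrightarrow> y \<le> k \<longrightarrow>
               Qstar n k f W q c h \<gamma> mstar (x, y, G (x, y)) =
                 min (Qstar n k f W q c h \<gamma> mstar (x, y, False)) (Qstar n k f W q c h \<gamma> mstar (x, y, True)))
            \<longrightarrow> (\<forall>g. Jval f W q S1 c h \<gamma> (\<lambda>t os as. G (track k mstar os))
                     \<le> Jval f W q S1 c h \<gamma> g + \<epsilon>))"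
proof -
  interpret sampled_collection n f W k q \<gamma> cmax c h mstar
    by unfold_locales (use assms in auto)
  have a: "AE \<omega> in M. (\<lambda>\<tau>. Qlearn n k f W c h \<gamma> mstar \<alpha> \<xi> \<tau> z \<omega>) \<longlonglongrightarrow> Qs z" if "z \<in> Dom n k" for z
  proof (rule q_learning_converges[where F = F and \<alpha> = \<alpha> and \<xi> = \<xi>, OF M])
    show "measure M (E \<inter> {\<omega> \<in> space M. \<xi> t z \<omega> = v}) = measure M E * sample_law n f W q z v"
      if "z \<in> Dom n k" "E \<in> sets (F t)" for t z v E
      using sample_law that by blast
    show "Qlearn n k f W c h \<gamma> mstar \<alpha> \<xi> (Suc t) z \<omega> =
        (1 - \<alpha> t z \<omega>) * Qlearn n k f W c h \<gamma> mstar \<alpha> \<xi> t z \<omega> +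
        \<alpha> t z \<omega> * target (\<lambda>z'. Qlearn n k f W c h \<gamma> mstar \<alpha> \<xi> t z' \<omega>) z (\<xi> t z \<omega>)" for t z \<omega>
      by (rule Qlearn_Suc)
  qed (use that filt alpha_meas alpha_range sample_meas alpha_sum alpha_sq in \<open>auto intro: Qstar_fixed_point(1)\<close>)
  have gap: "2 * (\<gamma> ^ Suc k * vmax) \<le> \<epsilon>"
  \<comment> \<open>Here the quotient by \<open>2 * cmax\<close> is 0 by convention and the
    condition on \<open>k\<close> carries no information, but \<open>vmax\<close> vanishes.\<close>
  proof (cases "cmax = 0")
    case True
    thus ?thesis using eps unfolding vmax_def by simp
  next
    case False
    hence pos: "0 < cmax" using cmax_nonneg by simp
    define X where "X = (1 - \<gamma>) * \<epsilon> / (2 * cmax)"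
    have X: "0 < X" using pos gamma eps by (simp add: X_def)
    \<comment> \<open>Multiplication by the negative number \<open>ln \<gamma>\<close> reverses the
      inequality.\<close>
    have "real k * ln \<gamma> \<le> ln X"
      using k gamma unfolding X_def[symmetric] by (simp add: divide_le_eq)
    hence "ln (\<gamma> ^ k) \<le> ln X" using gamma by (simp add: ln_realpow)
    hence "\<gamma> ^ k \<le> X" using X gamma by (subst (asm) ln_le_cancel_iff) auto
    hence "\<gamma> ^ Suc k * (2 * cmax) \<le> \<gamma> * X * (2 * cmax)"
      using gamma pos by simp
    also have "\<gamma> * X * (2 * cmax) = \<gamma> * ((1 - \<gamma>) * \<epsilon>)"
      using pos by (simp add: X_def)
    also have "\<dots> \<le> 1 * ((1 - \<gamma>) * \<epsilon>)"
      using gamma eps by (intro mult_right_mono) auto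
    finally show ?thesis using gamma by (simp add: vmax_def field_simps)
  qed
  have b: "Jval f W q S1 c h \<gamma> (\<lambda>t os as. G (track k mstar os)) \<le> Jval f W q S1 c h \<gamma> g + \<epsilon>"
    if G: "\<And>x y. x \<in> Mn n \<Longrightarrow> y \<le> k \<Longrightarrow> Qs (x, y, G (x, y)) = min (Qs (x, y, False)) (Qs (x, y, True))" for G g
  proof -
    interpret G: collection_run n f W k q \<gamma> cmax c h mstar S1 "\<lambda>t os as. G (track k mstar os)"
      by unfold_locales (use init in auto)
    interpret g: collection_run n f W k q \<gamma> cmax c h mstar S1 g
      by unfold_locales (use init in auto)
    \<comment> \<open>Before the first action the law does not depend on the strategy, so both
      estimates refer to the same number.\<close>
    have "G.mean 0 = g.mean 0"
      by (simp add: G.mean_def g.mean_def fun_eq_iff)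
    moreover have "Qs (fst (track k mstar os), snd (track k mstar os), G (track k mstar os)) = best (track k mstar os)"
      if "(s, os, as) \<in> set_pmf (G.D t)" for t s os as
      using G[of "fst (track k mstar os)" "snd (track k mstar os)"] G.set_D[OF that]
      by (simp add: best_def split_def)
    ultimately show ?thesis
      using G.Jval_greedy g.Jval_lower gap by fastforce
  qed
  show ?thesis using a b by blast
qed

end
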